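(* (In ZFC.) There is a Hausdorff space $X$ which is strongly anti-Urysohn and satisfies $F(X) = \omega$, $w(X) \le \mathfrak{c}$, and $|X| = 2^{\mathfrak{c}}$.
   Context: A Hausdorff space $X$ is strongly anti-Urysohn (SAU) if it has at least two non-isolated points and any two infinite closed subsets of $X$ intersect. A free sequence in a topological space $X$ is a sequence $\langle x_\alpha : \alpha < \eta\rangle$ of points of $X$ indexed by an ordinal $\eta$ such that for every $\beta < \eta$ we have $\overline{\{x_\alpha : \alpha < \beta\}} \cap \overline{\{x_\alpha : \beta \le \alpha < \eta\}} = \emptyset$. A subset $S \subset X$ is free in $X$ if it admits an (injective) indexing by ordinals that turns it into a free sequence in $X$. $F(X)$ is the supremum of the cardinalities of the free subsets of $X$. $w(X)$ denotes the weight of $X$, and $\mathfrak{c} = 2^{\omega}$. *)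

theory Defs
  imports "HOL-Analysis.Analysis"
begin

unbundle cardinal_syntax

definition strongly_anti_Urysohn :: "'a topology \<Rightarrow> bool" where
  "strongly_anti_Urysohn X \<longleftrightarrow>
     Hausdorff_space X \<and>
     (\<exists>p\<in>topspace X. \<exists>q\<in>topspace X. p \<noteq> q \<and> \<not> openin X {p} \<and> \<not> openin X {q}) \<and>
     (\<forall>A B. closedin X A \<and> infinite A \<and> closedin X B \<and> infinite B \<longrightarrow> A \<inter> B \<noteq> {})"

(* An ordinal is represented by a (reflexive) well-order r; its elements are those of Field r. *)
definition free_sequence :: "'a topology \<Rightarrow> 'i rel \<Rightarrow> ('i \<Rightarrow> 'a) \<Rightarrow> bool" where
  "free_sequence X r x \<longleftrightarrow>
     Well_order r \<and> x ` Field r \<subseteq> topspace X \<and>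
     (\<forall>\<beta>\<in>Field r. X closure_of (x ` underS r \<beta>) \<inter> X closure_of (x ` above r \<beta>) = {})"

(* Only well-orders on the type of the points are used as index orders. Nothing is lost: see
   free_set_indexI. *)
definition free_set :: "'a topology \<Rightarrow> 'a set \<Rightarrow> bool" where
  "free_set X S \<longleftrightarrow>
     (\<exists>(r :: 'a rel) x. free_sequence X r x \<and> inj_on x (Field r) \<and> x ` Field r = S)"

(* Least element of a set of cardinals, and least upper bound of a set of cardinals, determined up
   to =o. The least upper bound of cardinals of subsets of a type is the cardinal of a subset of
   that type, so the search for it may be restricted to that type: see card_Sup_upper and
   card_Sup_least. *)
definition card_Min :: "'a rel set \<Rightarrow> 'a rel" where
  "card_Min K = (SOME \<kappa>. \<kappa> \<in> K \<and> (\<forall>r\<in>K. \<kappa> \<le>o r))"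

definition card_Sup :: "'a rel set \<Rightarrow> 'a rel" where
  "card_Sup K = card_Min {\<kappa>. Card_order \<kappa> \<and> (\<forall>r\<in>K. r \<le>o \<kappa>)}"

definition free_number :: "'a topology \<Rightarrow> 'a rel" where
  "free_number X = card_Sup {|S| | S. free_set X S}"

definition base_of :: "'a topology \<Rightarrow> 'a set set \<Rightarrow> bool" where
  "base_of X \<B> \<longleftrightarrow>
     (\<forall>V\<in>\<B>. openin X V) \<and>
     (\<forall>U x. openin X U \<and> x \<in> U \<longrightarrow> (\<exists>V\<in>\<B>. x \<in> V \<and> V \<subseteq> U))"

definition weight :: "'a topology \<Rightarrow> 'a set rel" where
  "weight X = card_Min {|\<B>| | \<B>. base_of X \<B>}"

definition continuum :: "(nat \<Rightarrow> bool) rel" where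
  "continuum = ctwo ^c natLeq"

lemma card_Min:
  assumes "K \<noteq> {}" and "\<forall>r\<in>K. Card_order r"
  shows "card_Min K \<in> K \<and> (\<forall>r\<in>K. card_Min K \<le>o r)"
proof -
  have "\<forall>r\<in>K. Well_order r" using assms(2) card_order_on_well_order_on by blast
  then have "\<exists>\<kappa>. \<kappa> \<in> K \<and> (\<forall>r\<in>K. \<kappa> \<le>o r)"
    using exists_minim_Well_order[OF assms(1)] by blast
  then show ?thesis unfolding card_Min_def by (rule someI_ex)
qed

lemma card_Sup_aux:
  fixes K :: "'a rel set"
  assumes "\<forall>r\<in>K. Card_order r"
  shows "Card_order (card_Sup K) \<and> (\<forall>r\<in>K. r \<le>o card_Sup K) \<and>
    (\<forall>\<kappa> :: 'a rel. Card_order \<kappa> \<and> (\<forall>r\<in>K. r \<le>o \<kappa>) \<longrightarrow> card_Sup K \<le>o \<kappa>)"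
proof -
  let ?U = "{\<kappa> :: 'a rel. Card_order \<kappa> \<and> (\<forall>r\<in>K. r \<le>o \<kappa>)}"
  have "r \<le>o |UNIV :: 'a set|" if "r \<in> K" for r
    using card_of_mono1[of "Field r" UNIV] card_of_Field_ordIso[of r] that assms subset_UNIV
    by (meson ordIso_ordLeq_trans ordIso_symmetric)
  then have "?U \<noteq> {}" using card_of_Card_order[of "UNIV :: 'a set"] by blast
  from card_Min[OF this] show ?thesis unfolding card_Sup_def by auto
qed

lemma card_Sup_upper:
  assumes "\<forall>r\<in>K. Card_order r" and "r \<in> K"
  shows "r \<le>o card_Sup K"
  using card_Sup_aux[OF assms(1)] assms(2) by blast

lemma card_Sup_least:
  fixes K :: "'a rel set" and \<kappa> :: "'b rel"
  assumes K: "\<forall>r\<in>K. Card_order r" and \<kappa>: "Card_order \<kappa>" "\<forall>r\<in>K. r \<le>o \<kappa>"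
  shows "card_Sup K \<le>o \<kappa>"
proof (rule ccontr)
  assume "\<not> card_Sup K \<le>o \<kappa>"
  then have "\<kappa> <o card_Sup K"
    using card_Sup_aux[OF K] \<kappa>(1) by (metis card_order_on_well_order_on not_ordLeq_iff_ordLess)
  then have "|Field \<kappa>| \<le>o |Field (card_Sup K)|"
    using \<kappa>(1) card_Sup_aux[OF K] card_of_mono2 ordLess_imp_ordLeq by blast
  then obtain f where f: "inj_on f (Field \<kappa>)" "f ` Field \<kappa> \<subseteq> Field (card_Sup K)"
    using card_of_ordLeq[of "Field \<kappa>" "Field (card_Sup K)"] by blast
  have "\<kappa> =o |Field \<kappa>|" using \<kappa>(1) card_of_Field_ordIso ordIso_symmetric by blast
  also have "|Field \<kappa>| =o |f ` Field \<kappa>|"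
    using f(1) card_of_ordIsoI inj_on_imp_bij_betw by blast
  finally have iso: "\<kappa> =o |f ` Field \<kappa>|" .
  have "card_Sup K \<le>o |f ` Field \<kappa>|"
    using card_Sup_aux[OF K] \<kappa>(2) iso card_of_Card_order ordLeq_ordIso_trans by blast
  then have "card_Sup K \<le>o \<kappa>"
    using iso ordIso_symmetric ordLeq_ordIso_trans by blast
  then show False using \<open>\<not> card_Sup K \<le>o \<kappa>\<close> by simp
qed

lemma free_set_indexI:
  fixes r :: "'i rel" and x :: "'i \<Rightarrow> 'a"
  assumes fs: "free_sequence X r x" and inj: "inj_on x (Field r)"
  shows "free_set X (x ` Field r)"
proof -
  have r: "Well_order r" using fs by (simp add: free_sequence_def)
  have F: "Field (dir_image r x) = x ` Field r" by (rule dir_image_Field)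
  have u: "underS (dir_image r x) (x b) = x ` underS r b" if "b \<in> Field r" for b
    using inj that unfolding underS_def dir_image_def inj_on_def
    by (auto simp: Field_def) blast+
  have a: "above (dir_image r x) (x b) = x ` above r b" if "b \<in> Field r" for b
    using inj that unfolding above_def dir_image_def inj_on_def
    by (auto simp: Field_def)
  have "free_sequence X (dir_image r x) (\<lambda>y. y)"
    using fs Well_order_dir_image[OF r inj] unfolding free_sequence_def F by (auto simp: u a)
  then show ?thesis unfolding free_set_def using F by (metis image_ident inj_on_id2)
qed

end

theory Submission
  imports Defs
begin

text \<open>
  The points are well-founded trees, grown from countably many leaves: whenever
  \<open>s\<close> and \<open>t\<close> are injective sequences of points with disjoint ranges, every label \<open>l\<close> gives a new
  point \<open>node l s t\<close>. Each node \<open>x\<close> carries a free ultrafilter \<open>w x\<close> on the natural numbers, and a set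
  is declared open if, with a node \<open>x = node l s t\<close>, it contains both \<open>s n\<close> and \<open>t n\<close> for
  \<open>w x\<close>-almost all \<open>n\<close>. Thus \<open>x\<close> lies in the closure of both sequences. Two infinite closed sets
  \<open>A\<close> and \<open>B\<close> must then meet: if they were disjoint, sequences \<open>s\<close> in \<open>A\<close> and \<open>t\<close> in \<open>B\<close> would have
  a common limit (\<open>closed_sets_meet\<close>). The labels provide \<open>2\<close> to the power continuum many points.

  The whole difficulty is the Hausdorff property. Only countably many nodes lie below two given
  points \<open>x\<close> and \<open>y\<close>. Suppose that each such node \<open>z\<close> can be given a set of children, large with
  respect to \<open>w z\<close>, such that these sets are pairwise disjoint. Then
  every point has at most one parent, and the sets of points reachable from \<open>x\<close> and from \<open>y\<close>
  are disjoint and open (\<open>opn_separation\<close>). The images of the ultrafilters \<open>w z\<close> under the sequences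
  must therefore have the property that every countable family of them has pairwise disjoint members. It suffices
  that all \<open>w z\<close> are weak P-points, that is, not in the closure of any countable set of other
  free ultrafilters, and that no two of them are images of each other (\<open>disjoint_images\<close>).

  Weak P-points are found with the method of Kunen. An ultrafilter \<open>p\<close> is an OK point if for all
  members \<open>U n\<close> of \<open>p\<close> there are continuum many members \<open>V X\<close> of \<open>p\<close> such that more than \<open>n\<close> of them
  have an intersection that is almost contained in \<open>U n\<close>. If \<open>U n\<close> is not in \<open>u n\<close>, then \<open>u n\<close>
  contains at most \<open>n\<close> of the sets \<open>V X\<close>, so that some \<open>V X\<close> is in no \<open>u n\<close>
  (\<open>OK_point_weak_P_point\<close>). OK points are built by a recursion of length continuum (\<open>decide_all\<close>)
  from an independent linked family (\<open>linked_family_exists\<close>). Using half of the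
  independent family for branching gives \<open>2\<close> to the power continuum many of them; each is
  equivalent to at most continuum many others, so there are as many inequivalent ones.

  Finally, the topology is made coarser. Every nonempty open set contains leaves, so sets of leaves
  generate a coarser topology which is still Hausdorff and has at most continuum many basic sets; a
  coarser topology has fewer closed sets, so any two infinite ones still meet. In a strongly
  anti-Urysohn space free sets are countable, since an uncountable one could be cut into two
  infinite pieces with disjoint closures (\<open>free_set_countable\<close>); the leaves are an infinite free set.
\<close>

section \<open>Independent linked families\<close>

text \<open>The sets \<open>L Y X n\<close> with fixed \<open>Y\<close> form a linked system: one may intersect \<open>n\<close> of them, but not
  more, and still be left with an infinite set. The index \<open>Y\<close> counts
  the independent systems, the index \<open>X\<close> the members of a system.\<close>

locale linked_family =
  fixes L :: "nat set \<Rightarrow> nat set \<Rightarrow> nat \<Rightarrow> nat set"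
  assumes L_mono: "m \<le> n \<Longrightarrow> L Y X m \<subseteq> L Y X n"
    and L_linked: "finite \<Xi> \<Longrightarrow> n < card \<Xi> \<Longrightarrow> finite (\<Inter>X\<in>\<Xi>. L Y X n)"
    and L_indep: "finite \<tau> \<Longrightarrow> infinite (\<Inter>(Y, X)\<in>\<tau>. L Y X (card (\<tau> `` {Y})))"

lemma separating_initial_segment:
  fixes \<Y> :: "nat set set"
  assumes "finite \<Y>"
  obtains m where "\<And>k. m \<le> k \<Longrightarrow> inj_on (\<lambda>Y. Y \<inter> {..<k}) \<Y>"
proof -
  define d where "d = (\<lambda>(Y, Z). LEAST i :: nat. (i \<in> Y) \<noteq> (i \<in> Z))"
  define m where "m = Suc (Max (insert 0 (d ` (\<Y> \<times> \<Y>))))"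
  have "inj_on (\<lambda>Y. Y \<inter> {..<k}) \<Y>" if "m \<le> k" for k
  proof (rule inj_onI, rule ccontr)
    fix Y Z assume YZ: "Y \<in> \<Y>" "Z \<in> \<Y>" "Y \<inter> {..<k} = Z \<inter> {..<k}" "Y \<noteq> Z"
    then have "\<exists>i. (i \<in> Y) \<noteq> (i \<in> Z)" by blast
    then have 1: "(d (Y, Z) \<in> Y) \<noteq> (d (Y, Z) \<in> Z)"
      unfolding d_def prod.case by (rule LeastI_ex)
    have "d (Y, Z) \<le> Max (insert 0 (d ` (\<Y> \<times> \<Y>)))"
      using assms YZ by (intro Max_ge) auto
    then have "d (Y, Z) < k" using that by (simp add: m_def)
    then show False using 1 YZ(3) by blast
  qed
  then show ?thesis using that by blast
qed

text \<open>Kunen's witness lives on the countable set of pairs \<open>(k, f)\<close> in which \<open>f\<close> is a finite relation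
  between subsets of \<open>{..<k}\<close>. Such a pair belongs to the set for \<open>Y\<close>, \<open>X\<close>, \<open>n\<close> if \<open>f\<close> relates the
  trace of \<open>Y\<close> on \<open>{..<k}\<close> to at most \<open>n\<close> sets, among them the trace of \<open>X\<close>. Finitely many sets have
  distinct traces for all large \<open>k\<close>: this bounds \<open>k\<close> when more than \<open>n\<close> sets \<open>X\<close> are used, and lets
  \<open>f\<close> be prescribed independently for distinct \<open>Y\<close>.\<close>

lemma linked_family_exists: "\<exists>L. linked_family L"
proof -
  define K :: "(nat \<times> (nat set \<times> nat set) set) set"
    where "K = (SIGMA k:UNIV. Pow (Pow {..<k} \<times> Pow {..<k}))"
  define M where "M Y X n = {(k, f) \<in> K. card (f `` {Y \<inter> {..<k}}) \<le> n \<and> X \<inter> {..<k} \<in> f `` {Y \<inter> {..<k}}}"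
    for Y X :: "nat set" and n :: nat
  have "countable K" unfolding K_def by (intro countable_SIGMA) (auto intro!: countable_finite)
  moreover have "infinite K"
  proof -
    have "range (\<lambda>k. (k, {})) \<subseteq> K" by (auto simp: K_def)
    moreover have "infinite (range (\<lambda>k::nat. (k, {}::(nat set \<times> nat set) set)))"
      by (rule range_inj_infinite) (auto intro: injI)
    ultimately show ?thesis using finite_subset by blast
  qed
  ultimately obtain b :: "nat \<Rightarrow> nat \<times> (nat set \<times> nat set) set" where b: "bij_betw b UNIV K"
    using bij_betw_from_nat_into by blast
  have inf: "infinite (b -` A)" if "infinite A" "A \<subseteq> K" for A
  proof
    assume "finite (b -` A)"
    then have "finite (b ` (b -` A))" by (rule finite_imageI)
    moreover have "b ` (b -` A) = A" using that(2) b by (auto simp: bij_betw_def)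
    ultimately show False using that(1) by simp
  qed
  have fin: "finite (b -` A)" if "finite A" for A
    using that b by (simp add: bij_betw_def finite_vimageI)
  have "linked_family (\<lambda>Y X n. b -` M Y X n)"
  proof
    show "b -` M Y X m \<subseteq> b -` M Y X n" if "m \<le> n" for m n Y X
      using that by (auto simp: M_def)
  next
    fix \<Xi> :: "nat set set" and n Y assume \<Xi>: "finite \<Xi>" "n < card \<Xi>"
    obtain m where m: "\<And>k. m \<le> k \<Longrightarrow> inj_on (\<lambda>X. X \<inter> {..<k}) \<Xi>"
      using separating_initial_segment[OF \<Xi>(1)] by blast
    have "(\<Inter>X\<in>\<Xi>. M Y X n) \<subseteq> (SIGMA k:{..<m}. Pow (Pow {..<k} \<times> Pow {..<k}))"
    proof
      fix z assume z: "z \<in> (\<Inter>X\<in>\<Xi>. M Y X n)"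
      obtain k f where kf: "z = (k, f)" by (cases z)
      have ne: "\<Xi> \<noteq> {}" using \<Xi> by auto
      then have K: "f \<subseteq> Pow {..<k} \<times> Pow {..<k}" and c: "card (f `` {Y \<inter> {..<k}}) \<le> n"
        using z by (auto simp: kf M_def K_def)
      have "k < m"
      proof (rule ccontr)
        assume "\<not> k < m"
        then have "card \<Xi> = card ((\<lambda>X. X \<inter> {..<k}) ` \<Xi>)" using m by (simp add: card_image)
        also have "\<dots> \<le> card (f `` {Y \<inter> {..<k}})"
        proof (rule card_mono)
          have "f `` {Y \<inter> {..<k}} \<subseteq> Pow {..<k}" using K by auto
          then show "finite (f `` {Y \<inter> {..<k}})" by (rule finite_subset) simp
          show "(\<lambda>X. X \<inter> {..<k}) ` \<Xi> \<subseteq> f `` {Y \<inter> {..<k}}" using z by (auto simp: kf M_def)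
        qed
        finally show False using c \<Xi>(2) by simp
      qed
      then show "z \<in> (SIGMA k:{..<m}. Pow (Pow {..<k} \<times> Pow {..<k}))" using K by (simp add: kf)
    qed
    then have "finite (\<Inter>X\<in>\<Xi>. M Y X n)" by (rule finite_subset) auto
    then show "finite (\<Inter>X\<in>\<Xi>. b -` M Y X n)" using fin by (simp flip: vimage_INT)
  next
    fix \<tau> :: "(nat set \<times> nat set) set" assume \<tau>: "finite \<tau>"
    obtain m where m: "\<And>k. m \<le> k \<Longrightarrow> inj_on (\<lambda>Y. Y \<inter> {..<k}) (fst ` \<tau>)"
      using separating_initial_segment \<tau> by (metis finite_imageI)
    define f where "f k = (\<lambda>(Y, X). (Y \<inter> {..<k}, X \<inter> {..<k})) ` \<tau>" for k :: nat
    let ?I = "\<Inter>(Y, X)\<in>\<tau>. M Y X (card (\<tau> `` {Y}))"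
    have mem: "(k, f k) \<in> ?I" if k: "m \<le> k" for k
    proof -
      have "(k, f k) \<in> M Y X (card (\<tau> `` {Y}))" if YX: "(Y, X) \<in> \<tau>" for Y X
      proof -
        have "f k `` {Y \<inter> {..<k}} \<subseteq> (\<lambda>X. X \<inter> {..<k}) ` (\<tau> `` {Y})"
        proof
          fix x assume "x \<in> f k `` {Y \<inter> {..<k}}"
          then obtain Y' X' where *: "(Y', X') \<in> \<tau>" "Y' \<inter> {..<k} = Y \<inter> {..<k}" "x = X' \<inter> {..<k}"
            by (auto simp: f_def)
          then have "Y' = Y" using m[OF k] YX by (force simp: inj_on_def)
          then show "x \<in> (\<lambda>X. X \<inter> {..<k}) ` (\<tau> `` {Y})" using * by auto
        qed
        moreover have fin\<tau>: "finite (\<tau> `` {Y})" using \<tau> by (rule finite_Image)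
        ultimately have "card (f k `` {Y \<inter> {..<k}}) \<le> card (\<tau> `` {Y})"
          by (meson card_image_le card_mono finite_imageI le_trans)
        moreover have "X \<inter> {..<k} \<in> f k `` {Y \<inter> {..<k}}" using YX by (force simp: f_def)
        moreover have "(k, f k) \<in> K" by (auto simp: K_def f_def)
        ultimately show ?thesis by (simp add: M_def)
      qed
      then show ?thesis by auto
    qed
    show "infinite (\<Inter>(Y, X)\<in>\<tau>. b -` M Y X (card (\<tau> `` {Y})))"
    proof (cases "\<tau> = {}")
      case False
      have "infinite ((\<lambda>k. (k, f k)) ` {m..})"
        by (subst finite_image_iff) (auto simp: inj_on_def infinite_Ici)
      moreover have "(\<lambda>k. (k, f k)) ` {m..} \<subseteq> ?I" using mem by auto
      ultimately have "infinite ?I" using finite_subset by blast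
      moreover have "?I \<subseteq> K" using False by (auto simp: M_def)
      ultimately have "infinite (b -` ?I)" by (rule inf)
      moreover have "b -` ?I = (\<Inter>(Y, X)\<in>\<tau>. b -` M Y X (card (\<tau> `` {Y})))" by auto
      ultimately show ?thesis by simp
    qed simp
  qed
  then show ?thesis by blast
qed

context linked_family
begin

definition block :: "(nat set \<times> nat set) set \<Rightarrow> nat set" where
  "block \<tau> = (\<Inter>(Y, X)\<in>\<tau>. L Y X (card (\<tau> `` {Y})))"

text \<open>\<open>F\<close> is a filter on the natural numbers, and the systems with an index outside \<open>W\<close> are independent
  modulo \<open>F\<close>. The set \<open>W\<close> consists of the indices that have been used up in building \<open>F\<close>.\<close>

definition indep :: "nat set set \<Rightarrow> nat set set \<Rightarrow> bool" where
  "indep F W \<longleftrightarrow> UNIV \<in> F \<and> (\<forall>G\<in>F. \<forall>H\<in>F. G \<inter> H \<in> F) \<and> (\<forall>G\<in>F. \<forall>H. G \<subseteq> H \<longrightarrow> H \<in> F) \<and>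
     (\<forall>G\<in>F. \<forall>\<tau> :: (nat set \<times> nat set) set.
        finite \<tau> \<and> fst ` \<tau> \<inter> W = {} \<longrightarrow> infinite (G \<inter> block \<tau>))"

lemma indep_infinite:
  "indep F W \<Longrightarrow> G \<in> F \<Longrightarrow> finite \<tau> \<Longrightarrow> fst ` \<tau> \<inter> W = {} \<Longrightarrow> infinite (G \<inter> block \<tau>)"
  by (simp add: indep_def)

lemma indep_Int: "indep F W \<Longrightarrow> G \<in> F \<Longrightarrow> H \<in> F \<Longrightarrow> G \<inter> H \<in> F"
  by (simp add: indep_def)

lemma indep_up: "indep F W \<Longrightarrow> G \<in> F \<Longrightarrow> G \<subseteq> H \<Longrightarrow> H \<in> F"
  unfolding indep_def by blast

lemma block_Un:
  fixes \<sigma> \<tau> :: "(nat set \<times> nat set) set"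
  assumes "fst ` \<sigma> \<inter> fst ` \<tau> = {}"
  shows "block (\<sigma> \<union> \<tau>) = block \<sigma> \<inter> block \<tau>"
proof -
  have empty: "\<rho>' `` {fst z} = {}" if "z \<in> \<rho>" "fst ` \<rho> \<inter> fst ` \<rho>' = {}"
    for z and \<rho> \<rho>' :: "(nat set \<times> nat set) set"
  proof -
    have "fst z \<notin> fst ` \<rho>'" using imageI[OF that(1), of fst] that(2) by blast
    then show ?thesis by (metis Image_singleton_iff all_not_in_conv fst_conv imageI)
  qed
  have 1: "(\<sigma> \<union> \<tau>) `` {fst z} = \<sigma> `` {fst z}" if "z \<in> \<sigma>" for z
    using empty[OF that assms] by (simp add: Un_Image)
  have 2: "(\<sigma> \<union> \<tau>) `` {fst z} = \<tau> `` {fst z}" if "z \<in> \<tau>" for z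
    using empty[OF that, of \<sigma>] assms by (simp add: Un_Image Int_commute)
  show ?thesis using 1 2 unfolding block_def case_prod_beta INT_Un by simp
qed

lemma indep_extend:
  assumes F: "indep F W" and W: "W \<subseteq> W'" and ne: "\<C> \<noteq> {}"
    and dir: "\<And>C D. C \<in> \<C> \<Longrightarrow> D \<in> \<C> \<Longrightarrow> \<exists>E\<in>\<C>. E \<subseteq> C \<inter> D"
    and inf: "\<And>G C (\<tau> :: (nat set \<times> nat set) set). G \<in> F \<Longrightarrow> C \<in> \<C> \<Longrightarrow> finite \<tau> \<Longrightarrow> fst ` \<tau> \<inter> W' = {} \<Longrightarrow>
      infinite (G \<inter> C \<inter> block \<tau>)"
  obtains F' where "F \<subseteq> F'" "\<C> \<subseteq> F'" "indep F' W'"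
proof
  let ?F = "{H. \<exists>G\<in>F. \<exists>C\<in>\<C>. G \<inter> C \<subseteq> H}"
  show "F \<subseteq> ?F" using ne by blast
  have UNIV: "UNIV \<in> F" using F by (simp add: indep_def)
  then show "\<C> \<subseteq> ?F" by blast
  show "indep ?F W'"
    unfolding indep_def
  proof (intro conjI ballI allI impI)
    show "UNIV \<in> ?F" using ne UNIV by blast
  next
    fix H H' assume H: "H \<in> ?F" and H': "H' \<in> ?F"
    from H obtain G C where 1: "G \<in> F" "C \<in> \<C>" "G \<inter> C \<subseteq> H" by auto
    from H' obtain G' C' where 2: "G' \<in> F" "C' \<in> \<C>" "G' \<inter> C' \<subseteq> H'" by auto
    obtain E where E: "E \<in> \<C>" "E \<subseteq> C \<inter> C'" using dir[OF 1(2) 2(2)] by auto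
    have "G \<inter> G' \<in> F" by (rule indep_Int[OF F 1(1) 2(1)])
    moreover have "(G \<inter> G') \<inter> E \<subseteq> H \<inter> H'" using 1(3) 2(3) E(2) by auto
    ultimately show "H \<inter> H' \<in> ?F" using E(1) by auto
  next
    fix H H' assume "H \<in> ?F" "H \<subseteq> H'" then show "H' \<in> ?F" by blast
  next
    fix H and \<tau> :: "(nat set \<times> nat set) set"
    assume "H \<in> ?F" and \<tau>: "finite \<tau> \<and> fst ` \<tau> \<inter> W' = {}"
    then obtain G C where "G \<in> F" "C \<in> \<C>" "G \<inter> C \<subseteq> H" by auto
    then have "infinite (G \<inter> C \<inter> block \<tau>)" using inf[of G C \<tau>] \<tau> by simp
    moreover have "G \<inter> C \<inter> block \<tau> \<subseteq> H \<inter> block \<tau>" using \<open>G \<inter> C \<subseteq> H\<close> by blast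
    ultimately show "infinite (H \<inter> block \<tau>)" using finite_subset by blast
  qed
qed

lemma indep_Union:
  assumes ne: "I \<noteq> {}" and F: "\<And>i. i \<in> I \<Longrightarrow> indep (F i) (W i)"
    and chain: "\<And>i j. i \<in> I \<Longrightarrow> j \<in> I \<Longrightarrow> F i \<subseteq> F j \<or> F j \<subseteq> F i"
    and W: "\<And>i. i \<in> I \<Longrightarrow> W i \<subseteq> W'"
  shows "indep (\<Union>i\<in>I. F i) W'"
  unfolding indep_def
proof (intro conjI ballI allI impI)
  show "UNIV \<in> (\<Union>i\<in>I. F i)" using ne F unfolding indep_def by blast
next
  fix G H assume "G \<in> (\<Union>i\<in>I. F i)" "H \<in> (\<Union>i\<in>I. F i)"
  then obtain i j where "i \<in> I" "G \<in> F i" "j \<in> I" "H \<in> F j" by blast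
  then obtain k where "k \<in> I" "G \<in> F k" "H \<in> F k" using chain[of i j] by blast
  then show "G \<inter> H \<in> (\<Union>i\<in>I. F i)" using indep_Int[OF F[of k]] by blast
next
  fix G H assume "G \<in> (\<Union>i\<in>I. F i)" "G \<subseteq> H"
  then obtain i where "i \<in> I" "G \<in> F i" by blast
  then have "H \<in> F i" using indep_up[OF F[of i]] \<open>G \<subseteq> H\<close> by blast
  then show "H \<in> (\<Union>i\<in>I. F i)" using \<open>i \<in> I\<close> by blast
next
  fix G and \<tau> :: "(nat set \<times> nat set) set"
  assume "G \<in> (\<Union>i\<in>I. F i)" and \<tau>: "finite \<tau> \<and> fst ` \<tau> \<inter> W' = {}"
  then obtain i where i: "i \<in> I" "G \<in> F i" by blast
  then have "fst ` \<tau> \<inter> W i = {}" using W[of i] \<tau> by blast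
  then show "infinite (G \<inter> block \<tau>)" using indep_infinite[OF F[of i]] i \<tau> by simp
qed

text \<open>Applied to a constant sequence \<open>U\<close>, this says that \<open>F\<close> contains the set or its complement, so that
  one kind of requirement covers both being an ultrafilter and being an OK point.\<close>

definition decided :: "nat set set \<Rightarrow> (nat \<Rightarrow> nat set) \<Rightarrow> bool" where
  "decided F U \<longleftrightarrow> (\<exists>n. - (\<Inter>m\<le>n. U m) \<in> F) \<or>
     (\<forall>n. U n \<in> F) \<and>
     (\<exists>V :: nat set \<Rightarrow> nat set. (\<forall>X. V X \<in> F) \<and>
        (\<forall>n \<Xi>. finite \<Xi> \<and> n < card \<Xi> \<longrightarrow> finite ((\<Inter>X\<in>\<Xi>. V X) - U n)))"

text \<open>If some \<open>\<Inter>m\<le>n. U m\<close> cannot be added to the filter while keeping it independent, then its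
  complement can, at the cost of the finitely many indices in the obstruction. Otherwise all \<open>U n\<close>
  are added, and one unused system \<open>Y\<close> is spent on the sets \<open>V X\<close>: a point that leaves the decreasing
  sequence of the \<open>T n\<close> at stage \<open>n\<close> is put into \<open>V X\<close> if it is in \<open>L Y X n\<close>. Inside \<open>T k\<close> the set
  \<open>V X\<close> contains \<open>L Y X k\<close>, which keeps independence; outside \<open>U n\<close> it is contained in \<open>L Y X n\<close>,
  which gives linkedness.\<close>

lemma decide_step:
  assumes F: "indep F W" and W: "W \<noteq> UNIV"
  obtains F' N where "F \<subseteq> F'" "finite N" "indep F' (W \<union> N)" "decided F' U"
proof (cases "\<forall>G\<in>F. \<forall>n (\<tau> :: (nat set \<times> nat set) set). finite \<tau> \<and> fst ` \<tau> \<inter> W = {} \<longrightarrow> infinite (G \<inter> (\<Inter>m\<le>n. U m) \<inter> block \<tau>)")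
  case True
  obtain Y where Y: "Y \<notin> W" using W by blast
  \<comment> \<open>Removing the points below \<open>n\<close> makes the intersection of all \<open>T n\<close> empty, so every point of \<open>T 0\<close> leaves the sequence.\<close>
  define T where "T n = (\<Inter>m\<le>n. U m) \<inter> {n..}" for n
  have T_anti: "T n \<subseteq> T m" if "m \<le> n" for m n using that by (auto simp: T_def)
  define V where "V X = {x. \<exists>n. x \<in> L Y X n \<and> x \<in> T n \<and> x \<notin> T (Suc n)}" for X
  have big: "x \<in> V X" if "x \<in> T k" "x \<in> L Y X k" for x X k
  proof -
    have "\<not> (\<forall>n\<ge>k. x \<in> T n)"
    proof
      assume "\<forall>n\<ge>k. x \<in> T n"
      then have "x \<in> T (max k (Suc x))" by simp
      then show False by (simp add: T_def)
    qed
    then obtain n0 where n0: "n0 \<ge> k" "x \<notin> T n0" by blast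
    have "\<exists>n\<ge>k. x \<in> T n \<and> x \<notin> T (Suc n)"
    proof (rule ccontr)
      assume *: "\<not> ?thesis"
      have "x \<in> T n" if "n \<ge> k" for n
        using that
      proof (induction n rule: dec_induct)
        case base
        show ?case by (rule \<open>x \<in> T k\<close>)
      next
        case (step n)
        then show ?case using * by blast
      qed
      then show False using n0 by blast
    qed
    then obtain n where "n \<ge> k" "x \<in> T n" "x \<notin> T (Suc n)" by blast
    then show ?thesis using that(2) L_mono[of k n Y X] by (auto simp: V_def)
  qed
  define \<C> where "\<C> = {(\<Inter>m\<le>n. U m) \<inter> (\<Inter>X\<in>\<Xi>. V X) | n \<Xi>. finite \<Xi>}"
  obtain F' where F': "F \<subseteq> F'" "\<C> \<subseteq> F'" "indep F' (W \<union> {Y})"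
  proof (rule indep_extend[OF F, of "W \<union> {Y}" \<C>])
    show "\<C> \<noteq> {}" by (auto simp: \<C>_def)
    fix C D assume "C \<in> \<C>" "D \<in> \<C>"
    then obtain n \<Xi> n' \<Xi>' where *: "C = (\<Inter>m\<le>n. U m) \<inter> (\<Inter>X\<in>\<Xi>. V X)" "finite \<Xi>"
      "D = (\<Inter>m\<le>n'. U m) \<inter> (\<Inter>X\<in>\<Xi>'. V X)" "finite \<Xi>'" unfolding \<C>_def by blast
    have "(\<Inter>m\<le>max n n'. U m) \<inter> (\<Inter>X\<in>\<Xi> \<union> \<Xi>'. V X) \<in> \<C>"
      unfolding \<C>_def using * by blast
    moreover have "(\<Inter>m\<le>max n n'. U m) \<inter> (\<Inter>X\<in>\<Xi> \<union> \<Xi>'. V X) \<subseteq> C \<inter> D"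
      unfolding * by auto
    ultimately show "\<exists>E\<in>\<C>. E \<subseteq> C \<inter> D" by blast
  next
    fix G C and \<tau> :: "(nat set \<times> nat set) set" assume G: "G \<in> F" and "C \<in> \<C>" and \<tau>: "finite \<tau>" "fst ` \<tau> \<inter> (W \<union> {Y}) = {}"
    then obtain n \<Xi> where C: "C = (\<Inter>m\<le>n. U m) \<inter> (\<Inter>X\<in>\<Xi>. V X)" "finite \<Xi>"
      unfolding \<C>_def by blast
    define k where "k = max n (card \<Xi>)"
    define \<sigma> where "\<sigma> = Pair Y ` \<Xi>"
    have \<sigma>Y: "\<sigma> `` {Y} = \<Xi>" by (auto simp: \<sigma>_def)
    have "fst ` \<sigma> \<subseteq> {Y}" by (auto simp: \<sigma>_def)
    then have dis: "fst ` \<sigma> \<inter> fst ` \<tau> = {}" and W\<sigma>: "fst ` (\<sigma> \<union> \<tau>) \<inter> W = {}" using \<tau>(2) Y by auto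
    have "finite (\<sigma> \<union> \<tau>)" using C(2) \<tau>(1) by (simp add: \<sigma>_def)
    then have "infinite (G \<inter> (\<Inter>m\<le>k. U m) \<inter> block (\<sigma> \<union> \<tau>))"
      using True G W\<sigma> by simp
    then have "infinite (G \<inter> (\<Inter>m\<le>k. U m) \<inter> block (\<sigma> \<union> \<tau>) - {..<k})"
      by (intro Diff_infinite_finite) auto
    moreover have "G \<inter> (\<Inter>m\<le>k. U m) \<inter> block (\<sigma> \<union> \<tau>) - {..<k} \<subseteq> G \<inter> C \<inter> block \<tau>"
    proof
      fix x assume x: "x \<in> G \<inter> (\<Inter>m\<le>k. U m) \<inter> block (\<sigma> \<union> \<tau>) - {..<k}"
      then have x\<tau>: "x \<in> block \<tau>" and x\<sigma>: "x \<in> block \<sigma>" using block_Un[OF dis] by blast+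
      have Tk: "x \<in> T k" using x by (simp add: T_def)
      have "x \<in> V X" if X: "X \<in> \<Xi>" for X
      proof (rule big[OF Tk])
        have "(Y, X) \<in> \<sigma>" using X by (simp add: \<sigma>_def)
        then have "x \<in> L Y X (card (\<sigma> `` {Y}))" using x\<sigma> unfolding block_def by blast
        then show "x \<in> L Y X k" using L_mono[of "card \<Xi>" k Y X] unfolding \<sigma>Y k_def by auto
      qed
      moreover have "x \<in> (\<Inter>m\<le>n. U m)" using x by (simp add: k_def)
      ultimately show "x \<in> G \<inter> C \<inter> block \<tau>" using x x\<tau> unfolding C(1) by blast
    qed
    ultimately show "infinite (G \<inter> C \<inter> block \<tau>)" using finite_subset by blast
  qed auto
  have "U n \<in> F'" for n
  proof -
    have "(\<Inter>m\<le>n. U m) \<inter> (\<Inter>X\<in>{}. V X) \<in> \<C>" unfolding \<C>_def by blast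
    moreover have "(\<Inter>m\<le>n. U m) \<inter> (\<Inter>X\<in>{}. V X) \<subseteq> U n" by auto
    ultimately show ?thesis using F' indep_up by blast
  qed
  moreover have "V X \<in> F'" for X
  proof -
    have "(\<Inter>m\<le>0. U m) \<inter> (\<Inter>X\<in>{X}. V X) \<in> \<C>" unfolding \<C>_def by blast
    moreover have "(\<Inter>m\<le>0. U m) \<inter> (\<Inter>X\<in>{X}. V X) \<subseteq> V X" by auto
    ultimately show ?thesis using F' indep_up by blast
  qed
  moreover have "finite ((\<Inter>X\<in>\<Xi>. V X) - U n)" if \<Xi>: "finite \<Xi>" "n < card \<Xi>" for n \<Xi>
  proof (rule finite_subset)
    show "(\<Inter>X\<in>\<Xi>. V X) - U n \<subseteq> (\<Inter>X\<in>\<Xi>. L Y X n)"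
    proof
      fix x assume x: "x \<in> (\<Inter>X\<in>\<Xi>. V X) - U n"
      have "x \<in> L Y X n" if "X \<in> \<Xi>" for X
      proof -
        have "x \<in> V X" using x that by blast
        then obtain k where k: "x \<in> L Y X k" "x \<in> T k" unfolding V_def by blast
        have "x \<notin> U n" using x by blast
        then have "\<not> n \<le> k" using k(2) by (auto simp: T_def)
        then have "k \<le> n" by simp
        then show ?thesis using k L_mono by blast
      qed
      then show "x \<in> (\<Inter>X\<in>\<Xi>. L Y X n)" by blast
    qed
    show "finite (\<Inter>X\<in>\<Xi>. L Y X n)" using L_linked \<Xi> by blast
  qed
  ultimately have "decided F' U" unfolding decided_def by blast
  then show ?thesis by (intro that[OF F'(1) _ F'(3)]) auto
next
  case False
  then obtain G n \<tau> where *: "G \<in> F" "finite \<tau>" "fst ` \<tau> \<inter> W = {}" "finite (G \<inter> (\<Inter>m\<le>n. U m) \<inter> block \<tau>)"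
    by blast
  define C where "C = block \<tau> - (\<Inter>m\<le>n. U m)"
  obtain F' where F': "F \<subseteq> F'" "{C} \<subseteq> F'" "indep F' (W \<union> fst ` \<tau>)"
  proof (rule indep_extend[OF F, of "W \<union> fst ` \<tau>" "{C}"])
    fix H C' and \<tau>' :: "(nat set \<times> nat set) set" assume H: "H \<in> F" "C' \<in> {C}" "finite \<tau>'" "fst ` \<tau>' \<inter> (W \<union> fst ` \<tau>) = {}"
    have "H \<inter> G \<in> F" using H * indep_Int[OF F] by blast
    moreover have "finite (\<tau> \<union> \<tau>')" "fst ` (\<tau> \<union> \<tau>') \<inter> W = {}" using * H by auto
    ultimately have "infinite (H \<inter> G \<inter> block (\<tau> \<union> \<tau>'))" by (rule indep_infinite[OF F])
    moreover have "block (\<tau> \<union> \<tau>') = block \<tau> \<inter> block \<tau>'" by (rule block_Un) (use H in blast)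
    ultimately have "infinite (H \<inter> G \<inter> (block \<tau> \<inter> block \<tau>') - (G \<inter> (\<Inter>m\<le>n. U m) \<inter> block \<tau>))"
      using *(4) by (intro Diff_infinite_finite) auto
    moreover have "H \<inter> G \<inter> (block \<tau> \<inter> block \<tau>') - (G \<inter> (\<Inter>m\<le>n. U m) \<inter> block \<tau>) \<subseteq> H \<inter> C' \<inter> block \<tau>'"
      using H by (auto simp: C_def)
    ultimately show "infinite (H \<inter> C' \<inter> block \<tau>')" using finite_subset by blast
  qed auto
  have "- (\<Inter>m\<le>n. U m) \<in> F'"
  proof -
    have "C \<subseteq> - (\<Inter>m\<le>n. U m)" by (auto simp: C_def)
    then show ?thesis using F' indep_up by blast
  qed
  then have "decided F' U" unfolding decided_def by blast
  then show ?thesis using *(2) by (intro that[OF F'(1) _ F'(3)]) auto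
qed

end

section \<open>OK points are weak P-points\<close>

definition free_ultrafilter :: "nat set set \<Rightarrow> bool" where
  "free_ultrafilter p \<longleftrightarrow> (\<forall>A\<in>p. infinite A) \<and> (\<forall>A\<in>p. \<forall>B\<in>p. A \<inter> B \<in> p) \<and> (\<forall>A. A \<in> p \<or> - A \<in> p)"

lemma free_ultrafilter_up: "free_ultrafilter p \<Longrightarrow> A \<in> p \<Longrightarrow> A \<subseteq> B \<Longrightarrow> B \<in> p"
proof (rule ccontr)
  assume p: "free_ultrafilter p" "A \<in> p" "A \<subseteq> B" "B \<notin> p"
  then have "A \<inter> - B \<in> p" unfolding free_ultrafilter_def by blast
  moreover have "A \<inter> - B = {}" using p(3) by blast
  ultimately show False using p(1) unfolding free_ultrafilter_def by force
qed

lemma free_ultrafilter_Int: "free_ultrafilter p \<Longrightarrow> A \<in> p \<Longrightarrow> B \<in> p \<Longrightarrow> A \<inter> B \<in> p"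
  unfolding free_ultrafilter_def by blast

lemma free_ultrafilter_infinite: "free_ultrafilter p \<Longrightarrow> A \<in> p \<Longrightarrow> infinite A"
  unfolding free_ultrafilter_def by blast

lemma free_ultrafilter_Compl: "free_ultrafilter p \<Longrightarrow> - A \<in> p \<longleftrightarrow> A \<notin> p"
  using free_ultrafilter_infinite[of p "A \<inter> - A"] free_ultrafilter_Int[of p A "- A"]
  unfolding free_ultrafilter_def by auto

lemma free_ultrafilter_cofinite: "free_ultrafilter p \<Longrightarrow> finite (- A) \<Longrightarrow> A \<in> p"
  using free_ultrafilter_Compl free_ultrafilter_infinite by metis

lemma free_ultrafilter_INT:
  assumes p: "free_ultrafilter p" and "finite I" "\<And>i. i \<in> I \<Longrightarrow> A i \<in> p"
  shows "(\<Inter>i\<in>I. A i) \<in> p"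
  using assms(2,3)
proof (induction I)
  case empty
  then show ?case using free_ultrafilter_cofinite[OF p, of UNIV] by simp
next
  case (insert i I)
  then show ?case using free_ultrafilter_Int[OF p] by simp
qed

context linked_family
begin

lemma decided_mono: "decided F U \<Longrightarrow> F \<subseteq> F' \<Longrightarrow> decided F' U"
  unfolding decided_def by blast

text \<open>All sequences are decided one after the other, along a well-order in which every sequence has
  fewer than continuum many predecessors. As every step uses up finitely many indices, an
  unused one is always left.\<close>

lemma decide_all:
  assumes F0: "indep F0 W0" and W0: "|UNIV :: (nat \<Rightarrow> nat set) set| \<le>o |- W0|"
  obtains p where "F0 \<subseteq> p" "free_ultrafilter p" "\<And>U. decided p U"
proof -
  define r where "r = |UNIV :: (nat \<Rightarrow> nat set) set|"
  have r: "Card_order r" "Field r = UNIV" "Well_order r"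
    unfolding r_def by (rule card_of_Card_order, rule Field_card_of, rule card_of_Well_order)
  interpret r: wo_rel r using r(3) by (simp add: wo_rel_def)
  have infR: "infinite (UNIV :: (nat \<Rightarrow> nat set) set)"
  proof
    assume "finite (UNIV :: (nat \<Rightarrow> nat set) set)"
    then have "finite (range (\<lambda>i :: nat. \<lambda>_ :: nat. {i}))" by (rule finite_subset[OF subset_UNIV])
    moreover have "inj (\<lambda>i :: nat. \<lambda>_ :: nat. {i})" by (intro injI) (metis singleton_inject)
    ultimately show False using range_inj_infinite by blast
  qed
  define earlier where "earlier U = underS r U" for U
  define Fb where "Fb f U = F0 \<union> (\<Union>T\<in>earlier U. fst (f T))" for f :: "(nat \<Rightarrow> nat set) \<Rightarrow> nat set set \<times> nat set set" and U
  define Wb where "Wb f U = W0 \<union> (\<Union>T\<in>earlier U. snd (f T))" for f :: "(nat \<Rightarrow> nat set) \<Rightarrow> nat set set \<times> nat set set" and U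
  define P where "P f U s \<longleftrightarrow> Fb f U \<subseteq> fst s \<and> finite (snd s) \<and> indep (fst s) (Wb f U \<union> snd s) \<and> decided (fst s) U"
    for f :: "(nat \<Rightarrow> nat set) \<Rightarrow> nat set set \<times> nat set set" and U s
  have wf: "wf (r - Id)" using r(3) by (simp add: well_order_on_def)
  have ear: "(T, U) \<in> r - Id \<longleftrightarrow> T \<in> earlier U" for T U by (auto simp: earlier_def underS_def)
  have "\<exists>f. \<forall>U. P f U (f U)"
  proof (rule dependent_wf_choice[OF wf])
    fix f g :: "(nat \<Rightarrow> nat set) \<Rightarrow> nat set set \<times> nat set set" and U s
    assume "\<And>T. (T, U) \<in> r - Id \<Longrightarrow> f T = g T"
    then have "Fb f U = Fb g U" "Wb f U = Wb g U" unfolding Fb_def Wb_def ear by auto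
    then show "P f U s = P g U s" unfolding P_def by simp
  next
    fix U and f :: "(nat \<Rightarrow> nat set) \<Rightarrow> nat set set \<times> nat set set"
    assume "\<And>T. (T, U) \<in> r - Id \<Longrightarrow> P f T (f T)"
    then have IH: "P f T (f T)" if "T \<in> earlier U" for T using that ear by blast
    have trans: "earlier T \<subseteq> earlier U" if "T \<in> earlier U" for T
      using that r.TRANS r.ANTISYM unfolding earlier_def underS_def trans_def antisym_def by blast
    have sub: "fst (f S) \<subseteq> fst (f T)" if "S \<in> earlier T" "T \<in> earlier U" for S T
      using IH[OF that(2)] that(1) unfolding P_def Fb_def by blast
    have "indep (Fb f U) (Wb f U)"
    proof (cases "earlier U = {}")
      case True
      then show ?thesis using F0 by (simp add: Fb_def Wb_def)
    next
      case False
      have "indep (\<Union>T\<in>earlier U. fst (f T)) (Wb f U)"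
      proof (rule indep_Union[OF False])
        show "indep (fst (f T)) (Wb f T \<union> snd (f T))" if "T \<in> earlier U" for T
          using IH[OF that] by (simp add: P_def)
        show "fst (f S) \<subseteq> fst (f T) \<or> fst (f T) \<subseteq> fst (f S)" if "S \<in> earlier U" "T \<in> earlier U" for S T
        proof -
          have "S = T \<or> S \<in> earlier T \<or> T \<in> earlier S"
            using r.TOTALS r(2) by (auto simp: earlier_def underS_def)
          then show ?thesis using sub that by blast
        qed
        show "Wb f T \<union> snd (f T) \<subseteq> Wb f U" if "T \<in> earlier U" for T
          using trans[OF that] that unfolding Wb_def by blast
      qed
      moreover have "F0 \<subseteq> (\<Union>T\<in>earlier U. fst (f T))" using False IH unfolding P_def Fb_def by blast
      then have "Fb f U = (\<Union>T\<in>earlier U. fst (f T))" unfolding Fb_def by blast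
      ultimately show ?thesis by simp
    qed
    moreover have "Wb f U \<noteq> UNIV"
    proof
      assume "Wb f U = UNIV"
      then have "- W0 \<subseteq> (\<Union>T\<in>earlier U. snd (f T))" unfolding Wb_def by blast
      then have "|- W0| \<le>o |\<Union>T\<in>earlier U. snd (f T)|" by (rule card_of_mono1)
      then have le: "r \<le>o |\<Union>T\<in>earlier U. snd (f T)|" using W0 ordLeq_transitive unfolding r_def by blast
      have lt: "|earlier U| <o r" unfolding earlier_def using card_of_underS[OF r(1)] r(2) by simp
      have fin: "finite (snd (f T))" if "T \<in> earlier U" for T using IH[OF that] by (simp add: P_def)
      show False
      proof (cases "finite (earlier U)")
        case True
        then have "finite (\<Union>T\<in>earlier U. snd (f T))" using fin by blast
        then show False using le infR card_of_ordLeq_finite unfolding r_def by blast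
      next
        case False
        have "|\<Union>T\<in>earlier U. snd (f T)| \<le>o |earlier U|"
        proof (rule card_of_UNION_ordLeq_infinite[OF False])
          show "|earlier U| \<le>o |earlier U|" by (rule card_of_mono1) simp
          show "\<forall>T\<in>earlier U. |snd (f T)| \<le>o |earlier U|"
          proof
            fix T assume "T \<in> earlier U"
            then show "|snd (f T)| \<le>o |earlier U|"
              by (intro ordLess_imp_ordLeq finite_ordLess_infinite[OF card_of_Well_order card_of_Well_order])
                (simp_all add: Field_card_of fin False)
          qed
        qed
        then have "r \<le>o |earlier U|" using le ordLeq_transitive by blast
        then show False using lt not_ordLess_ordLeq by blast
      qed
    qed
    ultimately obtain F' N where "Fb f U \<subseteq> F'" "finite N" "indep F' (Wb f U \<union> N)" "decided F' U"
      by (rule decide_step)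
    then show "\<exists>s. P f U s" unfolding P_def by (intro exI[of _ "(F', N)"]) simp
  qed
  then obtain f where f: "P f U (f U)" for U by blast
  define p where "p = (\<Union>U. fst (f U))"
  have sub: "fst (f S) \<subseteq> fst (f T)" if "S \<in> earlier T" for S T
    using f[of T] that unfolding P_def Fb_def by blast
  have p: "indep p UNIV"
    unfolding p_def
  proof (rule indep_Union)
    show "indep (fst (f T)) (Wb f T \<union> snd (f T))" for T using f[of T] by (simp add: P_def)
    show "fst (f S) \<subseteq> fst (f T) \<or> fst (f T) \<subseteq> fst (f S)" for S T
    proof -
      have "S = T \<or> S \<in> earlier T \<or> T \<in> earlier S"
        using r.TOTALS r(2) by (auto simp: earlier_def underS_def)
      then show ?thesis using sub by blast
    qed
  qed auto
  have dec: "decided p U" for U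
    using f[of U] decided_mono[of "fst (f U)" U p] unfolding P_def p_def by blast
  show ?thesis
  proof (rule that[OF _ _ dec])
    show "F0 \<subseteq> p" using f[of undefined] unfolding P_def Fb_def p_def by blast
    have "infinite A" if "A \<in> p" for A
      using indep_infinite[OF p that, of "{}"] by (simp add: block_def)
    moreover have "A \<in> p \<or> - A \<in> p" for A
      using dec[of "\<lambda>_. A"] unfolding decided_def by auto
    ultimately show "free_ultrafilter p"
      using indep_Int[OF p] unfolding free_ultrafilter_def by blast
  qed
qed

end

definition OK_point :: "nat set set \<Rightarrow> bool" where
  "OK_point p \<longleftrightarrow> free_ultrafilter p \<and> (\<forall>U :: nat \<Rightarrow> nat set. (\<forall>n. U n \<in> p) \<longrightarrow>
     (\<exists>V :: nat set \<Rightarrow> nat set. (\<forall>X. V X \<in> p) \<and>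
        (\<forall>n \<Xi>. finite \<Xi> \<and> n < card \<Xi> \<longrightarrow> finite ((\<Inter>X\<in>\<Xi>. V X) - U n))))"

context linked_family
begin

text \<open>The indices \<open>c Y\<close>, which are the sets containing \<open>0\<close>, are spent at the start: for a given \<open>z\<close> the
  filter receives one of two almost disjoint members of the system \<open>c Y\<close>, depending on whether \<open>Y\<close> is
  in \<open>z\<close>. Hence different \<open>z\<close> lead to different ultrafilters. The remaining indices suffice for
  the recursion.\<close>

lemma OK_points_exist: "\<exists>w :: nat set set \<Rightarrow> nat set set. inj w \<and> (\<forall>z. OK_point (w z))"
proof -
  define c where "c Y = insert 0 (Suc ` Y)" for Y :: "nat set"
  define \<sigma> where "\<sigma> z = range (\<lambda>Y. (c Y, if Y \<in> z then UNIV else {} :: nat set))" for z :: "nat set set"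
  define W0 where "W0 = range c"
  have W0: "|UNIV :: (nat \<Rightarrow> nat set) set| \<le>o |- W0|"
  proof (rule card_of_ordLeqI)
    define h where "h U = {Suc (prod_encode (n, i)) | n i. i \<in> U n}" for U :: "nat \<Rightarrow> nat set"
    have h: "U n = {i. Suc (prod_encode (n, i)) \<in> h U}" for U n by (auto simp: h_def)
    show "inj_on h UNIV" 
    proof (rule injI)
      fix U U' assume "h U = h U'" then show "U = U'" using h[of U] h[of U'] by auto
    qed
    show "h U \<in> - W0" for U by (auto simp: h_def W0_def c_def)
  qed
  have "\<exists>p. OK_point p \<and> (\<forall>Y. L (c Y) (if Y \<in> z then UNIV else {}) 1 \<in> p)" for z
  proof -
    define \<C> where "\<C> = {\<Inter>(Y, X)\<in>\<tau>. L Y X 1 | \<tau>. finite \<tau> \<and> \<tau> \<subseteq> \<sigma> z}"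
    have base: "indep {UNIV} {}"
      using L_indep unfolding indep_def block_def by auto
    obtain F0 where F0: "\<C> \<subseteq> F0" "indep F0 W0"
    proof (rule indep_extend[OF base, of W0 \<C>])
      show "\<C> \<noteq> {}" unfolding \<C>_def by blast
    next
      fix C D assume C: "C \<in> \<C>" and D: "D \<in> \<C>"
      from C obtain \<tau> where 1: "C = (\<Inter>(Y, X)\<in>\<tau>. L Y X 1)" "finite \<tau>" "\<tau> \<subseteq> \<sigma> z"
        unfolding \<C>_def by auto
      from D obtain \<tau>' where 2: "D = (\<Inter>(Y, X)\<in>\<tau>'. L Y X 1)" "finite \<tau>'" "\<tau>' \<subseteq> \<sigma> z"
        unfolding \<C>_def by auto
      have "C \<inter> D = (\<Inter>(Y, X)\<in>\<tau> \<union> \<tau>'. L Y X 1)" unfolding 1(1) 2(1) by (rule INT_Un[symmetric])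
      moreover have "finite (\<tau> \<union> \<tau>')" "\<tau> \<union> \<tau>' \<subseteq> \<sigma> z" using 1 2 by auto
      ultimately have "C \<inter> D \<in> \<C>" unfolding \<C>_def by blast
      then show "\<exists>E\<in>\<C>. E \<subseteq> C \<inter> D" by blast
    next
      fix G C :: "nat set" and \<tau> :: "(nat set \<times> nat set) set"
      assume G: "G \<in> {UNIV}" and "C \<in> \<C>" and \<tau>: "finite \<tau>" "fst ` \<tau> \<inter> W0 = {}"
      from \<open>C \<in> \<C>\<close> obtain \<tau>'
        where C: "C = (\<Inter>(Y, X)\<in>\<tau>'. L Y X 1)" "finite \<tau>'" "\<tau>' \<subseteq> \<sigma> z"
        unfolding \<C>_def by auto
      have "card (\<tau>' `` {Y}) = 1" if "(Y, X) \<in> \<tau>'" for Y X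
      proof -
        have inj: "inj c"
        proof (rule injI)
          fix A B assume "c A = c B"
          then have "Suc ` A = Suc ` B" unfolding c_def by blast
          then show "A = B" by (simp add: inj_image_eq_iff)
        qed
        have eq: "X' = X" if "(Y, X') \<in> \<tau>'" for X'
        proof -
          have "(Y, X') \<in> \<sigma> z" "(Y, X) \<in> \<sigma> z" using that \<open>(Y, X) \<in> \<tau>'\<close> C(3) by blast+
          then obtain A B where "Y = c A" "X' = (if A \<in> z then UNIV else {})"
            "Y = c B" "X = (if B \<in> z then UNIV else {})" unfolding \<sigma>_def by auto
          then show ?thesis using injD[OF inj, of A B] by simp
        qed
        have "\<tau>' `` {Y} = {X}"
        proof (intro set_eqI iffI)
          show "v \<in> {X}" if "v \<in> \<tau>' `` {Y}" for v using eq[of v] that by simp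
          show "v \<in> \<tau>' `` {Y}" if "v \<in> {X}" for v using \<open>(Y, X) \<in> \<tau>'\<close> that by simp
        qed
        then show ?thesis by simp
      qed
      then have "C = block \<tau>'" unfolding C(1) block_def by (intro INF_cong) auto
      moreover have "fst ` \<tau>' \<inter> fst ` \<tau> = {}"
      proof -
        have "fst ` \<sigma> z \<subseteq> W0" by (auto simp: \<sigma>_def W0_def)
        then have "fst ` \<tau>' \<subseteq> W0" using image_mono[OF C(3), of fst] by (rule order_trans[rotated])
        then show ?thesis using \<tau>(2) by blast
      qed
      ultimately have "G \<inter> C \<inter> block \<tau> = block (\<tau>' \<union> \<tau>)" using G block_Un by simp
      moreover have "infinite (block (\<tau>' \<union> \<tau>))"
        using L_indep[of "\<tau>' \<union> \<tau>"] C(2) \<tau>(1) unfolding block_def by simp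
      ultimately show "infinite (G \<inter> C \<inter> block \<tau>)" by simp
    qed auto
    obtain p where p: "F0 \<subseteq> p" "free_ultrafilter p" "\<And>U. decided p U"
      using decide_all[OF F0(2) W0] by blast
    have "OK_point p"
      unfolding OK_point_def
    proof (intro conjI allI impI)
      show "free_ultrafilter p" by (rule p(2))
      fix U :: "nat \<Rightarrow> nat set" assume U: "\<forall>n. U n \<in> p"
      have "- (\<Inter>m\<le>n. U m) \<notin> p" for n
      proof -
        have "(\<Inter>m\<le>n. U m) \<in> p" using U by (intro free_ultrafilter_INT[OF p(2)]) simp_all
        then show ?thesis by (simp only: free_ultrafilter_Compl[OF p(2)] not_not)
      qed
      then show "\<exists>V :: nat set \<Rightarrow> nat set. (\<forall>X. V X \<in> p) \<and>
        (\<forall>n \<Xi>. finite \<Xi> \<and> n < card \<Xi> \<longrightarrow> finite ((\<Inter>X\<in>\<Xi>. V X) - U n))"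
        using p(3)[of U] unfolding decided_def by blast
    qed
    moreover have "L (c Y) (if Y \<in> z then UNIV else {}) 1 \<in> p" for Y
    proof -
      let ?\<tau> = "{(c Y, if Y \<in> z then UNIV else {})}"
      have "(\<Inter>(Y, X)\<in>?\<tau>. L Y X 1) \<in> \<C>" unfolding \<C>_def \<sigma>_def by blast
      then show ?thesis using F0(1) p(1) by auto
    qed
    ultimately show ?thesis by blast
  qed
  then have "\<exists>w. \<forall>z. OK_point (w z) \<and> (\<forall>Y. L (c Y) (if Y \<in> z then UNIV else {}) 1 \<in> w z)"
    by (intro choice allI)
  then obtain w where w: "\<And>z. OK_point (w z)" "\<And>z Y. L (c Y) (if Y \<in> z then UNIV else {}) 1 \<in> w z"
    by blast
  have "inj w"
  proof (rule injI, rule ccontr)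
    fix z z' assume eq: "w z = w z'" "z \<noteq> z'"
    then obtain Y where Y: "(Y \<in> z) \<noteq> (Y \<in> z')" by blast
    have "L (c Y) UNIV 1 \<in> w z \<and> L (c Y) {} 1 \<in> w z"
      using w(2)[of Y z] w(2)[of Y z'] Y eq(1) by (cases "Y \<in> z") simp_all
    then have "infinite (L (c Y) UNIV 1 \<inter> L (c Y) {} 1)"
      using w(1)[of z] free_ultrafilter_Int free_ultrafilter_infinite unfolding OK_point_def by blast
    moreover have "finite (\<Inter>X\<in>{UNIV, {}}. L (c Y) X 1)" by (rule L_linked) simp_all
    ultimately show False by simp
  qed
  then show ?thesis using w(1) by blast
qed

end

text \<open>For each \<open>n\<close>, only finitely many of the sets \<open>V X\<close> belong to the \<open>n\<close>-th ultrafilter of \<open>D\<close>, whereas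
  there are uncountably many \<open>X\<close>.\<close>

lemma OK_point_weak_P_point:
  assumes p: "OK_point p" and D: "countable D" "\<And>u. u \<in> D \<Longrightarrow> free_ultrafilter u" "p \<notin> D"
  obtains A where "A \<in> p" "\<And>u. u \<in> D \<Longrightarrow> A \<notin> u"
proof (cases "D = {}")
  case True
  then show ?thesis
    using that[of UNIV] p free_ultrafilter_cofinite[of p UNIV] by (simp add: OK_point_def)
next
  case False
  define u where "u = from_nat_into D"
  have u: "u n \<in> D" for n unfolding u_def using False by (rule from_nat_into)
  have range: "range u = D" unfolding u_def using range_from_nat_into[OF False D(1)] .
  have pf: "free_ultrafilter p" using p by (simp add: OK_point_def)
  have uf: "free_ultrafilter (u n)" for n using D(2) u by blast
  have "\<exists>A. A \<in> p \<and> A \<notin> u n" for n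
  proof (rule ccontr)
    assume "\<not> ?thesis"
    then have "p \<subseteq> u n" by blast
    moreover have "u n \<subseteq> p"
    proof
      fix A assume "A \<in> u n"
      then show "A \<in> p" using \<open>p \<subseteq> u n\<close> free_ultrafilter_Compl[OF pf, of A] free_ultrafilter_Compl[OF uf, of A n] by blast
    qed
    ultimately show False using D(3) u[of n] by (metis subset_antisym)
  qed
  then obtain U where U: "U n \<in> p" "U n \<notin> u n" for n by metis
  then obtain V :: "nat set \<Rightarrow> nat set" where V: "\<And>X. V X \<in> p"
    "\<And>n \<Xi>. finite \<Xi> \<Longrightarrow> n < card \<Xi> \<Longrightarrow> finite ((\<Inter>X\<in>\<Xi>. V X) - U n)"
    using p unfolding OK_point_def by metis
  have "countable {X. V X \<in> u n}" for n
  proof (rule countable_finite, rule ccontr)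
    assume "infinite {X. V X \<in> u n}"
    then obtain \<Xi> where \<Xi>: "finite \<Xi>" "card \<Xi> = Suc n" "\<Xi> \<subseteq> {X. V X \<in> u n}"
      using infinite_arbitrarily_large by blast
    have "(\<Inter>X\<in>\<Xi>. V X) \<in> u n" using \<Xi> by (intro free_ultrafilter_INT[OF uf]) auto
    then have "(\<Inter>X\<in>\<Xi>. V X) \<inter> - U n \<in> u n"
      using U(2) uf free_ultrafilter_Int free_ultrafilter_Compl by metis
    then show False using V(2)[of \<Xi> n] \<Xi> free_ultrafilter_infinite[OF uf] by (simp add: Diff_eq)
  qed
  then have "countable (\<Union>n. {X. V X \<in> u n})" by blast
  moreover have "uncountable (UNIV :: nat set set)"
  proof
    assume "countable (UNIV :: nat set set)"
    then have "range (from_nat_into (UNIV :: nat set set)) = Pow (UNIV :: nat set)"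
      using range_from_nat_into[of "UNIV :: nat set set"] by simp
    then show False using Cantors_theorem by metis
  qed
  ultimately have "(\<Union>n. {X. V X \<in> u n}) \<noteq> UNIV" by metis
  then obtain X where "\<forall>n. V X \<notin> u n" by auto
  then show ?thesis using that[of "V X"] V(1) range by auto
qed

section \<open>Inequivalent weak P-points\<close>

text \<open>Equivalence in the Rudin-Keisler order.\<close>

definition RK_equiv :: "nat set set \<Rightarrow> nat set set \<Rightarrow> bool" where
  "RK_equiv p q \<longleftrightarrow> (\<exists>g :: nat \<Rightarrow> nat. q = {A. g -` A \<in> p}) \<and> (\<exists>h :: nat \<Rightarrow> nat. p = {A. h -` A \<in> q})"

lemma RK_equiv_sym: "RK_equiv p q \<Longrightarrow> RK_equiv q p"
  by (simp add: RK_equiv_def)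

lemma RK_equiv_refl: "RK_equiv p p"
  unfolding RK_equiv_def by (intro conjI exI[of _ id]) simp_all

lemma RK_equiv_trans:
  assumes "RK_equiv p q" "RK_equiv q r"
  shows "RK_equiv p r"
proof -
  have comp: "\<exists>k :: nat \<Rightarrow> nat. r = {A. k -` A \<in> p}"
    if "\<exists>g :: nat \<Rightarrow> nat. q = {A. g -` A \<in> p}" "\<exists>h :: nat \<Rightarrow> nat. r = {A. h -` A \<in> q}" for p q r
  proof -
    from that obtain g h :: "nat \<Rightarrow> nat" where "q = {A. g -` A \<in> p}" "r = {A. h -` A \<in> q}" by blast
    then have "r = {A. (h \<circ> g) -` A \<in> p}" by (simp add: vimage_comp)
    then show ?thesis by blast
  qed
  show ?thesis using assms comp[of q p r] comp[of q r p] unfolding RK_equiv_def by simp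
qed

lemma card_functions_le: "|UNIV :: (nat \<Rightarrow> nat) set| \<le>o |UNIV :: nat set set|"
proof (rule card_of_ordLeqI)
  show "inj (\<lambda>g :: nat \<Rightarrow> nat. {prod_encode (n, g n) | n. True})"
  proof (rule injI)
    fix g g' :: "nat \<Rightarrow> nat"
    assume eq: "{prod_encode (n, g n) | n. True} = {prod_encode (n, g' n) | n. True}"
    show "g = g'"
    proof
      fix n
      have "prod_encode (n, g n) \<in> {prod_encode (n, g' n) | n. True}" unfolding eq[symmetric] by blast
      then show "g n = g' n" by auto
    qed
  qed
qed simp

text \<open>The classes are small, so fewer than \<open>|UNIV|\<close> many of them cannot cover the type; hence their
  representatives can be indexed by the type itself.\<close>

lemma inequivalent_representatives:
  fixes w :: "'a \<Rightarrow> 'b"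
  assumes inf: "infinite (UNIV :: 'c set)" and less: "|UNIV :: 'c set| <o |UNIV :: 'a set|"
    and small: "\<And>a. |{b. E a b}| \<le>o |UNIV :: 'c set|"
    and E: "\<And>a. E a a" "\<And>a b. E a b \<Longrightarrow> E b a" "\<And>a b c. E a b \<Longrightarrow> E b c \<Longrightarrow> E a c"
  shows "\<exists>e :: 'a \<Rightarrow> 'a. \<forall>a b. a \<noteq> b \<longrightarrow> \<not> E (e a) (e b)"
proof -
  define rep where "rep a = (SOME b. E a b)" for a
  have rep: "E a (rep a)" for a unfolding rep_def using E(1) by (rule someI)
  have rep_eq: "rep a = rep b" if "E a b" for a b
  proof -
    have "E a = E b" using E(2,3) that by blast
    then show ?thesis by (simp add: rep_def)
  qed
  define S where "S = range rep"
  have cover: "(UNIV :: 'a set) = (\<Union>s\<in>S. {b. E s b})"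
    using rep E(2) unfolding S_def by blast
  have "|UNIV :: 'a set| \<le>o |S|"
  proof (rule ccontr)
    assume "\<not> ?thesis"
    then have lt: "|S| <o |UNIV :: 'a set|" by (simp add: not_ordLeq_iff_ordLess card_of_Well_order)
    show False
    proof (cases "|S| \<le>o |UNIV :: 'c set|")
      case True
      have "|\<Union>s\<in>S. {b. E s b}| \<le>o |UNIV :: 'c set|"
        by (rule card_of_UNION_ordLeq_infinite[OF inf True]) (use small in blast)
      then show False using less not_ordLess_ordLeq unfolding cover[symmetric] by blast
    next
      case False
      then have le: "|UNIV :: 'c set| \<le>o |S|"
        by (meson card_of_Well_order not_ordLeq_iff_ordLess ordLess_imp_ordLeq)
      then have "infinite S" using inf card_of_ordLeq_finite by blast
      have "|\<Union>s\<in>S. {b. E s b}| \<le>o |S|"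
      proof (rule card_of_UNION_ordLeq_infinite[OF \<open>infinite S\<close>])
        show "|S| \<le>o |S|" by (rule card_of_mono1) simp
        show "\<forall>s\<in>S. |{b. E s b}| \<le>o |S|" using small le ordLeq_transitive by blast
      qed
      then show False using lt not_ordLess_ordLeq unfolding cover[symmetric] by blast
    qed
  qed
  then have "\<exists>e :: 'a \<Rightarrow> 'a. inj e \<and> range e \<subseteq> S" by (simp only: card_of_ordLeq)
  then obtain e :: "'a \<Rightarrow> 'a" where e: "inj e" "range e \<subseteq> S" by (elim exE conjE)
  have "\<not> E (e a) (e b)" if "a \<noteq> b" for a b
  proof
    assume E: "E (e a) (e b)"
    have S: "e a \<in> S" "e b \<in> S" using subsetD[OF e(2) rangeI] by this+
    have "rep s = s" if "s \<in> S" for s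
      using that rep_eq[OF rep, symmetric] unfolding S_def by (elim rangeE) simp
    then have "e a = e b" using rep_eq[OF E] S by simp
    then show False using e(1) that by (simp add: inj_eq)
  qed
  then show ?thesis by blast
qed

lemma inequivalent_OK_points:
  "\<exists>w :: nat set set \<Rightarrow> nat set set. (\<forall>z. OK_point (w z)) \<and> (\<forall>z z'. z \<noteq> z' \<longrightarrow> \<not> RK_equiv (w z) (w z'))"
proof -
  obtain L where "linked_family L" using linked_family_exists by (elim exE)
  from linked_family.OK_points_exist[OF this] obtain w :: "nat set set \<Rightarrow> nat set set"
    where w: "inj w" "\<And>z. OK_point (w z)" by (elim exE conjE) simp
  have "\<exists>e :: nat set set \<Rightarrow> nat set set. \<forall>a b. a \<noteq> b \<longrightarrow> \<not> RK_equiv (w (e a)) (w (e b))"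
  proof (rule inequivalent_representatives[where ?'c = "nat set"])
    have "infinite (range (\<lambda>n :: nat. {n}))" by (rule range_inj_infinite) (simp add: inj_def)
    then show "infinite (UNIV :: nat set set)" using finite_subset subset_UNIV by blast
    show "|UNIV :: nat set set| <o |UNIV :: nat set set set|"
      using card_of_Pow[of "UNIV :: nat set set"] by simp
    show "|{b. RK_equiv (w a) (w b)}| \<le>o |UNIV :: nat set set|" for a
    proof -
      have "{b. RK_equiv (w a) (w b)} \<subseteq> (\<lambda>g. inv w {A. g -` A \<in> w a}) ` (UNIV :: (nat \<Rightarrow> nat) set)"
      proof
        fix b assume "b \<in> {b. RK_equiv (w a) (w b)}"
        then obtain g :: "nat \<Rightarrow> nat" where "w b = {A. g -` A \<in> w a}" unfolding RK_equiv_def by blast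
        then have "b = inv w {A. g -` A \<in> w a}" using inv_f_f[OF w(1), of b] by simp
        then show "b \<in> (\<lambda>g. inv w {A. g -` A \<in> w a}) ` (UNIV :: (nat \<Rightarrow> nat) set)" by blast
      qed
      then have "|{b. RK_equiv (w a) (w b)}| \<le>o |UNIV :: (nat \<Rightarrow> nat) set|"
        by (meson card_of_image card_of_mono1 ordLeq_transitive)
      then show ?thesis using card_functions_le ordLeq_transitive by blast
    qed
  qed (use RK_equiv_refl RK_equiv_sym RK_equiv_trans in blast)+
  then obtain e :: "nat set set \<Rightarrow> nat set set"
    where e: "\<forall>a b. a \<noteq> b \<longrightarrow> \<not> RK_equiv (w (e a)) (w (e b))" by (elim exE)
  show ?thesis
  proof (intro exI conjI)
    show "\<forall>z. OK_point ((w \<circ> e) z)" by (simp add: w(2))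
    show "\<forall>z z'. z \<noteq> z' \<longrightarrow> \<not> RK_equiv ((w \<circ> e) z) ((w \<circ> e) z')" using e by (simp only: comp_apply)
  qed
qed

text \<open>To separate the image of \<open>p k\<close> from the images of the other ultrafilters, these are pulled back along
  \<open>s k\<close>, as far as they contain the range of \<open>s k\<close>. The results are free ultrafilters different from \<open>p k\<close> by
  inequivalence, so \<open>p k\<close> has a member that is in none of them. Sets that separate one image from all
  others are then made disjoint along an enumeration of \<open>Q\<close>.\<close>

lemma disjoint_images:
  fixes s :: "'k \<Rightarrow> nat \<Rightarrow> 'a" and p :: "'k \<Rightarrow> nat set set"
  assumes Q: "countable Q" and p: "\<And>k. k \<in> Q \<Longrightarrow> OK_point (p k)" and s: "\<And>k. k \<in> Q \<Longrightarrow> inj (s k)"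
    and diff: "\<And>j k. j \<in> Q \<Longrightarrow> k \<in> Q \<Longrightarrow> j \<noteq> k \<Longrightarrow>
      \<not> RK_equiv (p j) (p k) \<or> range (s j) \<inter> range (s k) = {}"
  obtains B where "\<And>k. k \<in> Q \<Longrightarrow> s k -` B k \<in> p k"
    and "\<And>j k. j \<in> Q \<Longrightarrow> k \<in> Q \<Longrightarrow> j \<noteq> k \<Longrightarrow> B j \<inter> B k = {}"
proof -
  have pf: "free_ultrafilter (p k)" if "k \<in> Q" for k using p[OF that] by (simp add: OK_point_def)
  have "\<exists>B. s k -` B \<in> p k \<and> (\<forall>j\<in>Q. j \<noteq> k \<longrightarrow> s j -` B \<notin> p j)" if k: "k \<in> Q" for k
  proof -
    define J where "J = {j \<in> Q. j \<noteq> k \<and> s j -` range (s k) \<in> p j}"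
    \<comment> \<open>the pullback along \<open>s k\<close> of the image of \<open>p j\<close> under \<open>s j\<close>\<close>
    define u where "u j = {A. s j -` s k ` A \<in> p j}" for j
    have u: "free_ultrafilter (u j)" and ne: "u j \<noteq> p k" if "j \<in> J" for j
    proof -
      have j: "j \<in> Q" "j \<noteq> k" "s j -` range (s k) \<in> p j" using that by (auto simp: J_def)
      note pj = pf[OF j(1)]
      show uf: "free_ultrafilter (u j)"
        unfolding free_ultrafilter_def
      proof (intro conjI ballI allI)
        fix A assume "A \<in> u j"
        then have "infinite (s j -` s k ` A)" using free_ultrafilter_infinite[OF pj] by (simp add: u_def)
        then show "infinite A" using finite_vimageI[OF _ s[OF j(1)]] by blast
      next
        fix A B assume "A \<in> u j" "B \<in> u j"
        then have "s j -` s k ` A \<inter> s j -` s k ` B \<in> p j"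
          using free_ultrafilter_Int[OF pj] by (simp add: u_def)
        then show "A \<inter> B \<in> u j" by (simp add: u_def image_Int[OF s[OF k]] vimage_Int)
      next
        fix A
        have "s j -` s k ` A \<in> p j \<or> s j -` range (s k) \<inter> - (s j -` s k ` A) \<in> p j"
          using free_ultrafilter_Int[OF pj j(3)] free_ultrafilter_Compl[OF pj] by blast
        moreover have "s j -` range (s k) \<inter> - (s j -` s k ` A) = s j -` s k ` (- A)"
          using s[OF k] by (auto simp: inj_image_mem_iff dest: injD)
        ultimately show "A \<in> u j \<or> - A \<in> u j" by (simp add: u_def)
      qed
      show "u j \<noteq> p k"
      proof
        assume eq: "u j = p k"
        have meet: "range (s j) \<inter> range (s k) \<noteq> {}"
        proof
          assume "range (s j) \<inter> range (s k) = {}"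
          then have "s j -` range (s k) = {}" by blast
          then show False using free_ultrafilter_infinite[OF pj j(3)] by simp
        qed
        have "p k = {A. (inv (s k) \<circ> s j) -` A \<in> p j}"
        proof (intro set_eqI)
          fix A
          have on: "s j -` range (s k) \<inter> s j -` s k ` A = s j -` range (s k) \<inter> (inv (s k) \<circ> s j) -` A"
            using s[OF k] by (auto simp: inv_f_f inj_eq)
          have "A \<in> p k \<longleftrightarrow> s j -` s k ` A \<in> p j" unfolding eq[symmetric] u_def by simp
          also have "\<dots> \<longleftrightarrow> s j -` range (s k) \<inter> s j -` s k ` A \<in> p j"
            using free_ultrafilter_Int[OF pj j(3)] free_ultrafilter_up[OF pj] by (meson Int_lower2)
          also have "\<dots> \<longleftrightarrow> (inv (s k) \<circ> s j) -` A \<in> p j"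
            unfolding on using free_ultrafilter_Int[OF pj j(3)] free_ultrafilter_up[OF pj] by (meson Int_lower2)
          finally show "A \<in> p k \<longleftrightarrow> A \<in> {A. (inv (s k) \<circ> s j) -` A \<in> p j}" by simp
        qed
        moreover have "p j = {A. (inv (s j) \<circ> s k) -` A \<in> p k}"
        proof (intro set_eqI)
          fix A
          have on: "s j -` s k ` ((inv (s j) \<circ> s k) -` A) = s j -` range (s k) \<inter> A"
          proof (intro set_eqI iffI)
            fix i assume "i \<in> s j -` s k ` ((inv (s j) \<circ> s k) -` A)"
            then obtain m where m: "s j i = s k m" "inv (s j) (s k m) \<in> A" by auto
            then have "i \<in> A" using inv_f_f[OF s[OF j(1)], of i] by simp
            then show "i \<in> s j -` range (s k) \<inter> A" using m(1) by blast
          next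
            fix i assume "i \<in> s j -` range (s k) \<inter> A"
            then obtain m where m: "s j i = s k m" "i \<in> A" by blast
            then have "inv (s j) (s k m) \<in> A" using inv_f_f[OF s[OF j(1)], of i] by simp
            then show "i \<in> s j -` s k ` ((inv (s j) \<circ> s k) -` A)" using m(1) by auto
          qed
          have "(inv (s j) \<circ> s k) -` A \<in> p k \<longleftrightarrow> s j -` range (s k) \<inter> A \<in> p j"
            unfolding eq[symmetric] u_def by (simp only: on mem_Collect_eq)
          also have "\<dots> \<longleftrightarrow> A \<in> p j"
            using free_ultrafilter_Int[OF pj j(3)] free_ultrafilter_up[OF pj] by (meson Int_lower2)
          finally show "A \<in> p j \<longleftrightarrow> A \<in> {A. (inv (s j) \<circ> s k) -` A \<in> p k}" by simp
        qed
        ultimately have "RK_equiv (p j) (p k)" unfolding RK_equiv_def by blast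
        then show False using diff[OF j(1) k j(2)] meet by blast
      qed
    qed
    have "countable (u ` J)" using Q by (simp add: J_def)
    then obtain A where A: "A \<in> p k" "\<And>v. v \<in> u ` J \<Longrightarrow> A \<notin> v"
      by (rule OK_point_weak_P_point[OF p[OF k]]) (use u ne in blast)+
    have "s j -` s k ` A \<notin> p j" if j: "j \<in> Q" "j \<noteq> k" for j
    proof (cases "j \<in> J")
      case True
      then show ?thesis using A(2)[of "u j"] by (simp add: u_def)
    next
      case False
      then have "s j -` range (s k) \<notin> p j" using j by (simp add: J_def)
      then show ?thesis using free_ultrafilter_up[OF pf[OF j(1)]] by (meson image_mono subset_UNIV vimage_mono)
    qed
    moreover have "s k -` s k ` A = A" using s[OF k] by (rule inj_vimage_image_eq)
    ultimately show ?thesis using A(1) by (intro exI[of _ "s k ` A"]) simp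
  qed
  then obtain B where B: "\<And>k. k \<in> Q \<Longrightarrow> s k -` B k \<in> p k"
    "\<And>k j. k \<in> Q \<Longrightarrow> j \<in> Q \<Longrightarrow> j \<noteq> k \<Longrightarrow> s j -` B k \<notin> p j"
    by metis
  define c where "c = to_nat_on Q"
  have c: "inj_on c Q" unfolding c_def using Q by (rule inj_on_to_nat_on)
  define B' where "B' k = B k - (\<Union>j\<in>{j \<in> Q. c j < c k}. B j)" for k
  have 1: "s k -` B' k \<in> p k" if k: "k \<in> Q" for k
  proof -
    have fin: "finite {j \<in> Q. c j < c k}"
    proof (rule inj_on_finite)
      show "inj_on c {j \<in> Q. c j < c k}" using c by (rule inj_on_subset) blast
      show "c ` {j \<in> Q. c j < c k} \<subseteq> {..<c k}" by blast
    qed simp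
    have "(\<Inter>j\<in>{j \<in> Q. c j < c k}. - (s k -` B j)) \<in> p k"
    proof (rule free_ultrafilter_INT[OF pf[OF k] fin])
      fix j assume "j \<in> {j \<in> Q. c j < c k}"
      then have "s k -` B j \<notin> p k" using B(2)[of j k] k by auto
      then show "- (s k -` B j) \<in> p k" using free_ultrafilter_Compl[OF pf[OF k]] by blast
    qed
    then have "s k -` B k \<inter> (\<Inter>j\<in>{j \<in> Q. c j < c k}. - (s k -` B j)) \<in> p k"
      using free_ultrafilter_Int[OF pf[OF k] B(1)[OF k]] by blast
    moreover have "s k -` B k \<inter> (\<Inter>j\<in>{j \<in> Q. c j < c k}. - (s k -` B j)) = s k -` B' k"
      unfolding B'_def by blast
    ultimately show ?thesis by simp
  qed
  have 2: "B' j \<inter> B' k = {}" if "j \<in> Q" "k \<in> Q" "j \<noteq> k" for j k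
  proof -
    have "c j \<noteq> c k" using c that by (auto dest: inj_onD)
    then consider "c j < c k" | "c k < c j" by linarith
    then show ?thesis using that by cases (auto simp: B'_def)
  qed
  show ?thesis by (rule that[OF 1 2])
qed

section \<open>The points\<close>

text \<open>\<open>tag\<close> is an injective pairing of a number with a set. It serves to code leaves and nodes as elements of
  a single type.\<close>

definition tag :: "nat \<Rightarrow> nat set \<Rightarrow> nat set" where
  "tag n A = insert (prod_encode (n, 0)) ((\<lambda>a. prod_encode (n, Suc a)) ` A)"

definition leaf :: "nat \<Rightarrow> nat set set" where
  "leaf n = {tag n {}}"

text \<open>The element \<open>{}\<close> tells nodes from leaves; the tags tell the label and the entries of the two
  sequences apart.\<close>

definition node :: "nat set set \<Rightarrow> (nat \<Rightarrow> nat set set) \<Rightarrow> (nat \<Rightarrow> nat set set) \<Rightarrow> nat set set" where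
  "node l s t = insert {} (tag 0 ` l \<union> (\<Union>n. tag (2 * n + 1) ` s n) \<union> (\<Union>n. tag (2 * n + 2) ` t n))"

lemma tag_eq_iff: "tag m A = tag n B \<longleftrightarrow> m = n \<and> A = B"
proof
  assume eq: "tag m A = tag n B"
  have "prod_encode (m, 0) \<in> tag n B" unfolding eq[symmetric] by (simp add: tag_def)
  then have mn: "m = n" by (auto simp: tag_def)
  have "A = {a. prod_encode (n, Suc a) \<in> tag m A}" using mn by (auto simp: tag_def)
  also have "\<dots> = B" unfolding eq by (auto simp: tag_def)
  finally show "m = n \<and> A = B" using mn by simp
qed simp

lemma tag_not_empty: "tag n A \<noteq> {}"
  by (simp add: tag_def)

lemma inj_leaf: "inj leaf"
  by (rule injI) (simp add: leaf_def tag_eq_iff)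

lemma leaf_neq_node: "leaf n \<noteq> node l s t"
proof
  assume "leaf n = node l s t"
  then have "{} \<in> leaf n" by (simp add: node_def)
  then show False using tag_not_empty[of n "{}"] by (simp add: leaf_def)
qed

lemma node_eq_iff: "node l s t = node l' s' t' \<longleftrightarrow> l = l' \<and> s = s' \<and> t = t'"
proof
  assume eq: "node l s t = node l' s' t'"
  have l: "l = {A. tag 0 A \<in> node l s t}" for l s t
    by (auto simp: node_def tag_eq_iff tag_not_empty)
  have s: "s n = {A. tag (2 * n + 1) A \<in> node l s t}" for l s t n
    by (auto simp: node_def tag_eq_iff tag_not_empty) presburger
  have t: "t n = {A. tag (2 * n + 2) A \<in> node l s t}" for l s t n
    by (auto simp: node_def tag_eq_iff tag_not_empty) presburger
  have "l = l'" by (subst l[of l s t], subst l[of l' s' t']) (simp only: eq)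
  moreover have "s = s'" by (rule ext, subst s[of s _ l t], subst s[of s' _ l' t']) (simp only: eq)
  moreover have "t = t'" by (rule ext, subst t[of t _ l s], subst t[of t' _ l' s']) (simp only: eq)
  ultimately show "l = l' \<and> s = s' \<and> t = t'" by simp
qed simp

inductive_set points :: "nat set set set" where
  leaf: "leaf n \<in> points"
| node: "inj s \<Longrightarrow> inj t \<Longrightarrow> range s \<inter> range t = {} \<Longrightarrow> (\<And>n. s n \<in> points) \<Longrightarrow> (\<And>n. t n \<in> points) \<Longrightarrow>
    node l s t \<in> points"

lemma node_in_pointsD:
  assumes "node l s t \<in> points"
  shows "inj s" "inj t" "range s \<inter> range t = {}" "s n \<in> points" "t n \<in> points"
  using assms by (cases rule: points.cases; simp add: leaf_neq_node[symmetric] node_eq_iff)+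

section \<open>The fine topology\<close>

locale ultrafilter_assignment =
  fixes w :: "nat set set \<Rightarrow> nat set set"
  assumes OK: "OK_point (w x)" and inequivalent: "x \<noteq> y \<Longrightarrow> \<not> RK_equiv (w x) (w y)"
begin

lemma w_free: "free_ultrafilter (w x)"
  using OK by (simp add: OK_point_def)

definition opn :: "nat set set set \<Rightarrow> bool" where
  "opn U \<longleftrightarrow> U \<subseteq> points \<and> (\<forall>l s t. node l s t \<in> U \<longrightarrow> {n. s n \<in> U \<and> t n \<in> U} \<in> w (node l s t))"

lemma opn_points: "opn points"
proof -
  have "{n. s n \<in> points \<and> t n \<in> points} = UNIV" if "node l s t \<in> points" for l s t
    using node_in_pointsD[OF that] by simp
  then show ?thesis using free_ultrafilter_cofinite[OF w_free, of UNIV] by (simp add: opn_def)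
qed

lemma opn_Int: "opn (U \<inter> V)" if U: "opn U" and V: "opn V"
  unfolding opn_def
proof (intro conjI allI impI)
  show "U \<inter> V \<subseteq> points" using U by (auto simp: opn_def)
  fix l s t assume "node l s t \<in> U \<inter> V"
  then have "{n. s n \<in> U \<and> t n \<in> U} \<inter> {n. s n \<in> V \<and> t n \<in> V} \<in> w (node l s t)"
    using U V free_ultrafilter_Int[OF w_free] unfolding opn_def by blast
  moreover have "{n. s n \<in> U \<and> t n \<in> U} \<inter> {n. s n \<in> V \<and> t n \<in> V}
      = {n. s n \<in> U \<inter> V \<and> t n \<in> U \<inter> V}" by blast
  ultimately show "{n. s n \<in> U \<inter> V \<and> t n \<in> U \<inter> V} \<in> w (node l s t)" by simp
qed

lemma opn_Union: "opn (\<Union>\<U>)" if opn: "\<And>U. U \<in> \<U> \<Longrightarrow> opn U"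
  unfolding opn_def
proof (intro conjI allI impI)
  show "\<Union>\<U> \<subseteq> points" using opn by (auto simp: opn_def)
  fix l s t assume "node l s t \<in> \<Union>\<U>"
  then obtain U where U: "U \<in> \<U>" "{n. s n \<in> U \<and> t n \<in> U} \<in> w (node l s t)"
    using opn unfolding opn_def by blast
  show "{n. s n \<in> \<Union>\<U> \<and> t n \<in> \<Union>\<U>} \<in> w (node l s t)"
    by (rule free_ultrafilter_up[OF w_free U(2)]) (use U(1) in blast)
qed

lemma opn_meets_leaves:
  assumes "x \<in> points" "opn U" "x \<in> U"
  shows "\<exists>n. leaf n \<in> U"
  using assms(1,3)
proof (induction rule: points.induct)
  case (node s t l)
  have "{n. s n \<in> U \<and> t n \<in> U} \<in> w (node l s t)"
    using assms(2) node.prems unfolding opn_def by blast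
  then have "{n. s n \<in> U \<and> t n \<in> U} \<noteq> {}" using free_ultrafilter_infinite[OF w_free] by fastforce
  then show ?case using node.IH by blast
qed blast

lemma node_in_closure:
  assumes "node l s t \<in> points" "opn (points - A)" "range s \<subseteq> A \<or> range t \<subseteq> A"
  shows "node l s t \<in> A"
proof (rule ccontr)
  assume "node l s t \<notin> A"
  then have "{n. s n \<in> points - A \<and> t n \<in> points - A} \<in> w (node l s t)"
    using assms(1,2) unfolding opn_def by blast
  moreover have "{n. s n \<in> points - A \<and> t n \<in> points - A} = {}" using assms(3) by blast
  ultimately show False using free_ultrafilter_infinite[OF w_free] by (metis finite.emptyI)
qed

lemma countable_child_closed:
  assumes "x \<in> points"
  shows "\<exists>D. countable D \<and> x \<in> D \<and> D \<subseteq> points \<and>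
    (\<forall>l s t n. node l s t \<in> D \<longrightarrow> s n \<in> D \<and> t n \<in> D)"
  using assms
proof (induction rule: points.induct)
  case (leaf n)
  show ?case
    by (rule exI[of _ "{leaf n}"]) (auto simp: points.leaf leaf_neq_node leaf_neq_node[symmetric])
next
  case (node s t l)
  let ?P = "\<lambda>D x. countable D \<and> x \<in> D \<and> D \<subseteq> points \<and>
    (\<forall>l s t n. node l s t \<in> D \<longrightarrow> s n \<in> D \<and> t n \<in> D)"
  have "\<exists>C. \<forall>n. ?P (C n) (s n)" by (intro choice allI node.IH(1))
  then obtain C where "\<forall>n. ?P (C n) (s n)" by (elim exE)
  then have C: "?P (C n) (s n)" for n by (rule spec)
  have "\<exists>D. \<forall>n. ?P (D n) (t n)" by (intro choice allI node.IH(2))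
  then obtain D where "\<forall>n. ?P (D n) (t n)" by (elim exE)
  then have D: "?P (D n) (t n)" for n by (rule spec)
  let ?E = "insert (node l s t) ((\<Union>n. C n) \<union> (\<Union>n. D n))"
  have "node l s t \<in> points" using node.hyps by (rule points.node)
  moreover have "s' n \<in> ?E \<and> t' n \<in> ?E" if E: "node l' s' t' \<in> ?E" for l' s' t' n
  proof -
    consider "l' = l \<and> s' = s \<and> t' = t" | m where "node l' s' t' \<in> C m" | m where "node l' s' t' \<in> D m"
      using E unfolding insert_iff Un_iff UN_iff node_eq_iff by blast
    then show ?thesis
    proof cases
      case 1
      then show ?thesis using C[of n] D[of n] by auto
    next
      case (2 m)
      then show ?thesis using C[of m] 2 by blast
    next
      case (3 m)
      then show ?thesis using D[of m] 3 by blast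
    qed
  qed
  moreover have "countable ?E" using C D by simp
  moreover have "?E \<subseteq> points" using \<open>node l s t \<in> points\<close> C D by simp blast
  ultimately show ?case by (intro exI[of _ ?E]) blast
qed

text \<open>Each node of \<open>Q\<close> has two image ultrafilters, one for each of its sequences. Those of distinct nodes are
  inequivalent, and those of a single node live on the disjoint ranges of its sequences, so the
  result on images applies to all of them at once.\<close>

lemma disjoint_children:
  assumes Q: "countable Q" "Q \<subseteq> points"
  obtains C where "\<And>l s t. node l s t \<in> Q \<Longrightarrow> {n. s n \<in> C (node l s t) \<and> t n \<in> C (node l s t)} \<in> w (node l s t)"
    and "\<And>x y. x \<noteq> y \<Longrightarrow> C x \<inter> C y = {}"
proof -
  define Q' where "Q' = {x \<in> Q. \<exists>l s t. x = node l s t} \<times> (UNIV :: bool set)"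
  \<comment> \<open>the sequence of the node \<open>x\<close> that is selected by \<open>b\<close>\<close>
  define \<sigma> where "\<sigma> = (\<lambda>(x, b). THE u. \<exists>l s t. x = node l s t \<and> u = (if b then s else t))"
  have \<sigma>: "\<sigma> (node l s t, b) = (if b then s else t)" for l s t b
    unfolding \<sigma>_def by (simp add: node_eq_iff)
  have inj\<sigma>: "inj (\<sigma> k)" if k': "k \<in> Q'" for k
  proof -
    obtain l s t b where k: "k = (node l s t, b)" "node l s t \<in> Q"
      using k' by (cases k) (auto simp: Q'_def)
    then show ?thesis using node_in_pointsD(1,2)[of l s t] Q(2) by (auto simp: \<sigma>)
  qed
  have cQ': "countable Q'" using Q(1) by (simp add: Q'_def)
  obtain B where B: "\<And>k. k \<in> Q' \<Longrightarrow> \<sigma> k -` B k \<in> w (fst k)"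
    "\<And>j k. j \<in> Q' \<Longrightarrow> k \<in> Q' \<Longrightarrow> j \<noteq> k \<Longrightarrow> B j \<inter> B k = {}"
  proof (rule disjoint_images[of Q' "\<lambda>k. w (fst k)" \<sigma>])
    fix j k assume jk: "j \<in> Q'" "k \<in> Q'" "j \<noteq> k"
    show "\<not> RK_equiv (w (fst j)) (w (fst k)) \<or> range (\<sigma> j) \<inter> range (\<sigma> k) = {}"
    proof (cases "fst j = fst k")
      case False
      then show ?thesis using inequivalent by blast
    next
      case True
      obtain l s t b where j: "j = (node l s t, b)" "node l s t \<in> Q"
        using jk(1) by (cases j) (auto simp: Q'_def)
      have k: "k = (node l s t, \<not> b)" using True jk(3) j(1) by (cases k) auto
      have "range s \<inter> range t = {}" using node_in_pointsD(3) j(2) Q(2) by blast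
      then show ?thesis unfolding j(1) k by (auto simp: \<sigma>)
    qed
  qed (use OK inj\<sigma> cQ' in auto)
  define C where "C x = (if \<exists>b. (x, b) \<in> Q' then B (x, True) \<union> B (x, False) else {})" for x
  show ?thesis
  proof (rule that[of C])
    fix l s t assume x: "node l s t \<in> Q"
    then have Q': "(node l s t, b) \<in> Q'" for b unfolding Q'_def by blast
    have "s -` B (node l s t, True) \<inter> t -` B (node l s t, False) \<in> w (node l s t)"
      using B(1)[OF Q', of True] B(1)[OF Q', of False] free_ultrafilter_Int[OF w_free] by (simp add: \<sigma>)
    then show "{n. s n \<in> C (node l s t) \<and> t n \<in> C (node l s t)} \<in> w (node l s t)"
      by (rule free_ultrafilter_up[OF w_free]) (use Q' in \<open>auto simp: C_def\<close>)
  next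
    fix x y :: "nat set set" assume xy: "x \<noteq> y"
    show "C x \<inter> C y = {}"
    proof (cases "(\<exists>b. (x, b) \<in> Q') \<and> (\<exists>b. (y, b) \<in> Q')")
      case True
      then have "(x, b) \<in> Q'" "(y, b) \<in> Q'" for b by (auto simp: Q'_def)
      then have "B (x, b) \<inter> B (y, b') = {}" for b b' using B(2) xy by blast
      then show ?thesis unfolding C_def by auto
    qed (auto simp: C_def)
  qed
qed

text \<open>Choose disjoint large sets of children for the countably many nodes below \<open>x\<close> and \<open>y\<close>, and leave out
  \<open>x\<close> and \<open>y\<close> themselves. In the resulting graph every point has at most one predecessor, and \<open>x\<close> and
  \<open>y\<close> have none, so nothing can be reached from both.\<close>

lemma opn_separation:
  assumes "x \<in> points" "y \<in> points" "x \<noteq> y"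
  obtains U V where "opn U" "opn V" "x \<in> U" "y \<in> V" "U \<inter> V = {}"
proof -
  obtain D where D: "countable D" "x \<in> D" "D \<subseteq> points"
    "\<forall>l s t n. node l s t \<in> D \<longrightarrow> s n \<in> D \<and> t n \<in> D"
    using countable_child_closed[OF assms(1)] by (elim exE conjE)
  obtain E where E: "countable E" "y \<in> E" "E \<subseteq> points"
    "\<forall>l s t n. node l s t \<in> E \<longrightarrow> s n \<in> E \<and> t n \<in> E"
    using countable_child_closed[OF assms(2)] by (elim exE conjE)
  define Q where "Q = D \<union> E"
  have Q: "countable Q" "Q \<subseteq> points" using D E by (simp_all add: Q_def)
  have Qc: "s n \<in> Q \<and> t n \<in> Q" if "node l s t \<in> Q" for l s t n
    using that D(4) E(4) unfolding Q_def by blast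
  obtain C where C: "\<And>l s t. node l s t \<in> Q \<Longrightarrow>
      {n. s n \<in> C (node l s t) \<and> t n \<in> C (node l s t)} \<in> w (node l s t)"
    "\<And>x y. x \<noteq> y \<Longrightarrow> C x \<inter> C y = {}"
    using disjoint_children[OF Q] by blast
  define R where "R = {(z, v). z \<in> Q \<and> v \<in> Q \<and> v \<in> C z - {x, y}}"
  have reach: "opn (R\<^sup>* `` {z})" if z: "z \<in> Q" for z
    unfolding opn_def
  proof (intro conjI allI impI)
    have RQ: "v \<in> Q" if "(z, v) \<in> R\<^sup>*" for v
      using that z by (induction rule: rtrancl_induct) (auto simp: R_def)
    then show "R\<^sup>* `` {z} \<subseteq> points" using Q(2) by blast
    fix l s t assume v: "node l s t \<in> R\<^sup>* `` {z}"
    then have vQ: "node l s t \<in> Q" using RQ by blast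
    then have inj: "inj s" "inj t" using node_in_pointsD(1,2) Q(2) by blast+
    have "finite (s -` {x, y} \<union> t -` {x, y})" using inj by (simp add: finite_vimageI)
    then have "- (s -` {x, y} \<union> t -` {x, y}) \<in> w (node l s t)"
      by (intro free_ultrafilter_cofinite[OF w_free]) simp
    then have "{n. s n \<in> C (node l s t) \<and> t n \<in> C (node l s t)} \<inter> - (s -` {x, y} \<union> t -` {x, y}) \<in> w (node l s t)"
      by (rule free_ultrafilter_Int[OF w_free C(1)[OF vQ]])
    then show "{n. s n \<in> R\<^sup>* `` {z} \<and> t n \<in> R\<^sup>* `` {z}} \<in> w (node l s t)"
    proof (rule free_ultrafilter_up[OF w_free])
      have "(z, u) \<in> R\<^sup>*" if "u \<in> C (node l s t)" "u \<in> Q" "u \<notin> {x, y}" for u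
      proof -
        have "(node l s t, u) \<in> R" using that vQ by (simp add: R_def)
        then show ?thesis using v by (meson Image_singleton_iff rtrancl.rtrancl_into_rtrancl)
      qed
      then show "{n. s n \<in> C (node l s t) \<and> t n \<in> C (node l s t)} \<inter> - (s -` {x, y} \<union> t -` {x, y})
          \<subseteq> {n. s n \<in> R\<^sup>* `` {z} \<and> t n \<in> R\<^sup>* `` {z}}"
        using Qc[OF vQ] by auto
    qed
  qed
  have notin: "v \<noteq> x \<and> v \<noteq> y" if "(z, v) \<in> R" for z v using that by (simp add: R_def)
  have uniq: "z = z'" if "(z, v) \<in> R" "(z', v) \<in> R" for z z' v
    using that C(2)[of z z'] by (auto simp: R_def)
  have "(y, v) \<notin> R\<^sup>*" if "(x, v) \<in> R\<^sup>*" for v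
    using that
  proof (induction rule: rtrancl_induct)
    case base
    show ?case
    proof
      assume "(y, x) \<in> R\<^sup>*"
      then show False using assms(3) notin by (cases rule: rtranclE) blast+
    qed
  next
    case (step u v)
    show ?case
    proof
      assume "(y, v) \<in> R\<^sup>*"
      then show False
      proof (cases rule: rtranclE)
        case base
        then show False using notin[OF step(2)] by simp
      next
        case (step u')
        then show False using uniq[OF \<open>(u, v) \<in> R\<close>] \<open>(y, u) \<notin> R\<^sup>*\<close> by blast
      qed
    qed
  qed
  then have "R\<^sup>* `` {x} \<inter> R\<^sup>* `` {y} = {}" by blast
  then show ?thesis using reach D(2) E(2) by (intro that[of "R\<^sup>* `` {x}" "R\<^sup>* `` {y}"]) (auto simp: Q_def)
qed

section \<open>The coarse topology\<close>

text \<open>These sets play the role of the regular open sets. As there are only countably many leaves,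
  there are at most continuum many sets of this form.\<close>

definition fill :: "nat set \<Rightarrow> nat set set set" where
  "fill E = \<Union>{U. opn U \<and> (\<forall>n. leaf n \<in> U \<longrightarrow> n \<in> E)}"

lemma opn_fill: "opn (fill E)"
  unfolding fill_def by (rule opn_Union) blast

lemma leaf_in_fillD: "leaf n \<in> fill E \<Longrightarrow> n \<in> E"
  unfolding fill_def by blast

lemma fill_greatest: "opn U \<Longrightarrow> (\<And>n. leaf n \<in> U \<Longrightarrow> n \<in> E) \<Longrightarrow> U \<subseteq> fill E"
  unfolding fill_def by blast

lemma fill_Int: "fill E \<inter> fill E' = fill (E \<inter> E')"
proof
  show "fill E \<inter> fill E' \<subseteq> fill (E \<inter> E')"
    using leaf_in_fillD by (intro fill_greatest opn_Int opn_fill) blast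
  have "fill (E \<inter> E') \<subseteq> fill F" if "E \<inter> E' \<subseteq> F" for F
    using leaf_in_fillD that by (intro fill_greatest opn_fill) blast
  then show "fill (E \<inter> E') \<subseteq> fill E \<inter> fill E'" by simp
qed

lemma fill_empty: "fill {} = {}"
proof (rule ccontr)
  assume "fill {} \<noteq> {}"
  then obtain x where "x \<in> fill {}" by blast
  moreover have "x \<in> points" using \<open>x \<in> fill {}\<close> opn_fill unfolding opn_def by blast
  ultimately obtain n where "leaf n \<in> fill {}" using opn_meets_leaves opn_fill by blast
  then show False using leaf_in_fillD by blast
qed

lemma fill_UNIV: "fill UNIV = points"
  using fill_greatest[OF opn_points, of UNIV] opn_fill[of UNIV] unfolding opn_def by blast

definition sau_topology :: "nat set set topology" where
  "sau_topology = topology (\<lambda>U. U \<subseteq> points \<and> (\<forall>x\<in>U. \<exists>E. x \<in> fill E \<and> fill E \<subseteq> U))"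

lemma openin_sau_topology: "openin sau_topology U \<longleftrightarrow> U \<subseteq> points \<and> (\<forall>x\<in>U. \<exists>E. x \<in> fill E \<and> fill E \<subseteq> U)"
proof -
  have "istopology (\<lambda>U. U \<subseteq> points \<and> (\<forall>x\<in>U. \<exists>E. x \<in> fill E \<and> fill E \<subseteq> U))"
    unfolding istopology_def
  proof (intro conjI allI impI ballI)
    fix S T x
    assume S: "S \<subseteq> points \<and> (\<forall>x\<in>S. \<exists>E. x \<in> fill E \<and> fill E \<subseteq> S)"
      and T: "T \<subseteq> points \<and> (\<forall>x\<in>T. \<exists>E. x \<in> fill E \<and> fill E \<subseteq> T)" and x: "x \<in> S \<inter> T"
    obtain E E' where "x \<in> fill E" "fill E \<subseteq> S" "x \<in> fill E'" "fill E' \<subseteq> T"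
      using S T x by (meson IntD1 IntD2)
    then have "x \<in> fill (E \<inter> E') \<and> fill (E \<inter> E') \<subseteq> S \<inter> T" using fill_Int[of E E'] by blast
    then show "\<exists>E. x \<in> fill E \<and> fill E \<subseteq> S \<inter> T" by blast
  next
    fix \<K> x
    assume "\<forall>K\<in>\<K>. K \<subseteq> points \<and> (\<forall>x\<in>K. \<exists>E. x \<in> fill E \<and> fill E \<subseteq> K)" "x \<in> \<Union>\<K>"
    then obtain K E where "K \<in> \<K>" "x \<in> fill E" "fill E \<subseteq> K" by blast
    then show "\<exists>E. x \<in> fill E \<and> fill E \<subseteq> \<Union>\<K>" by blast
  qed blast+
  then show ?thesis by (simp add: sau_topology_def topology_inverse')
qed

lemma openin_fill: "openin sau_topology (fill E)"
  using opn_fill[of E] unfolding openin_sau_topology opn_def by blast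

lemma topspace_sau_topology: "topspace sau_topology = points"
  unfolding topspace_def openin_sau_topology using fill_UNIV by blast

lemma opn_if_openin: "opn U" if "openin sau_topology U"
proof -
  have "U = \<Union>{fill E | E. fill E \<subseteq> U}" using that unfolding openin_sau_topology by blast
  moreover have "opn (\<Union>{fill E | E. fill E \<subseteq> U})" using opn_fill by (intro opn_Union) blast
  ultimately show ?thesis by simp
qed

text \<open>Disjoint open sets of the fine topology contain disjoint sets of leaves; replacing each set by the
  largest one with the same leaves keeps them disjoint, since the leaves are dense.\<close>

lemma Hausdorff_sau_topology: "Hausdorff_space sau_topology"
  unfolding Hausdorff_space_def topspace_sau_topology
proof (intro allI impI, elim conjE)
  fix x y assume "x \<in> points" "y \<in> points" "x \<noteq> y"
  then obtain U V where UV: "opn U" "opn V" "x \<in> U" "y \<in> V" "U \<inter> V = {}" by (rule opn_separation)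
  have "U \<subseteq> fill {n. leaf n \<in> U}" "V \<subseteq> fill {n. leaf n \<in> V}" using UV by (auto intro: fill_greatest[THEN subsetD])
  moreover have "disjnt (fill {n. leaf n \<in> U}) (fill {n. leaf n \<in> V})"
  proof -
    have "{n. leaf n \<in> U} \<inter> {n. leaf n \<in> V} = {}" using UV(5) by blast
    then show ?thesis unfolding disjnt_def fill_Int by (simp add: fill_empty)
  qed
  ultimately show "\<exists>U V. openin sau_topology U \<and> openin sau_topology V \<and> x \<in> U \<and> y \<in> V \<and> disjnt U V"
    using UV(3,4) openin_fill by (meson subsetD)
qed

text \<open>The sequences \<open>s\<close> in \<open>A\<close> and \<open>t\<close> in \<open>B\<close> define a point, which is in the closure of both.\<close>

lemma closed_sets_meet:
  assumes A: "closedin sau_topology A" "infinite A" and B: "closedin sau_topology B" "infinite B"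
  shows "A \<inter> B \<noteq> {}"
proof
  assume disj: "A \<inter> B = {}"
  obtain s :: "nat \<Rightarrow> nat set set" where s: "inj s" "range s \<subseteq> A"
    using A(2) infinite_countable_subset by blast
  obtain t :: "nat \<Rightarrow> nat set set" where t: "inj t" "range t \<subseteq> B"
    using B(2) infinite_countable_subset by blast
  have sub: "A \<subseteq> points" "B \<subseteq> points" using closedin_subset A(1) B(1) topspace_sau_topology by metis+
  have st: "range s \<inter> range t = {}" using s t disj by blast
  have "s n \<in> points" "t n \<in> points" for n using s(2) t(2) sub by blast+
  then have x: "node {} s t \<in> points" by (intro points.node s(1) t(1) st)
  have "opn (points - A)" "opn (points - B)"
    using A(1) B(1) opn_if_openin unfolding closedin_def topspace_sau_topology by blast+
  then have "node {} s t \<in> A" "node {} s t \<in> B"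
    using node_in_closure[OF x] s(2) t(2) by blast+
  then show False using disj by blast
qed

text \<open>The nodes over the leaves serve to show that there are non-isolated points, and as many points
  as labels.\<close>

definition basic_node :: "nat set set \<Rightarrow> nat set set" where
  "basic_node l = node l (\<lambda>n. leaf (2 * n)) (\<lambda>n. leaf (2 * n + 1))"

lemma basic_node_in_points: "basic_node l \<in> points"
  unfolding basic_node_def
proof (rule points.node)
  show "range (\<lambda>n. leaf (2 * n)) \<inter> range (\<lambda>n. leaf (2 * n + 1)) = {}"
  proof -
    have "leaf (2 * n) \<noteq> leaf (2 * m + 1)" for n m
    proof
      assume "leaf (2 * n) = leaf (2 * m + 1)"
      then have "2 * n = 2 * m + 1" by (rule injD[OF inj_leaf])
      then show False by presburger
    qed
    then show ?thesis by blast
  qed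
qed (auto intro!: injI points.leaf dest!: injD[OF inj_leaf])

lemma basic_node_not_isolated: "\<not> openin sau_topology {basic_node l}"
proof
  assume "openin sau_topology {basic_node l}"
  then have "{n. leaf (2 * n) \<in> {basic_node l} \<and> leaf (2 * n + 1) \<in> {basic_node l}} \<in> w (basic_node l)"
    using opn_if_openin unfolding opn_def basic_node_def by blast
  then show False
    using free_ultrafilter_infinite[OF w_free] leaf_neq_node unfolding basic_node_def by fastforce
qed

lemma inj_basic_node: "inj basic_node"
  by (rule injI) (simp add: basic_node_def node_eq_iff)

lemma strongly_anti_Urysohn_sau_topology: "strongly_anti_Urysohn sau_topology"
  unfolding strongly_anti_Urysohn_def
proof (intro conjI allI impI)
  have "basic_node {} \<noteq> basic_node UNIV" using inj_basic_node by (simp add: inj_eq)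
  then show "\<exists>p\<in>topspace sau_topology. \<exists>q\<in>topspace sau_topology. p \<noteq> q \<and> \<not> openin sau_topology {p} \<and> \<not> openin sau_topology {q}"
    using basic_node_in_points basic_node_not_isolated unfolding topspace_sau_topology by blast
qed (use Hausdorff_sau_topology closed_sets_meet in blast)+

lemma leaves_free: "free_set sau_topology (range leaf)"
proof -
  have "free_sequence sau_topology natLeq leaf"
    unfolding free_sequence_def
  proof (intro conjI ballI)
    show "Well_order natLeq" by (rule natLeq_Well_order)
    show "leaf ` Field natLeq \<subseteq> topspace sau_topology" using points.leaf topspace_sau_topology by blast
    fix k :: nat
    have u: "underS natLeq k = {..<k}" by (auto simp: underS_def natLeq_def)
    have a: "above natLeq k = {k..}" by (auto simp: above_def natLeq_def)
    have "closedin sau_topology (leaf ` {..<k})"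
      using closedin_Hausdorff_finite[OF Hausdorff_sau_topology] points.leaf topspace_sau_topology by (metis finite_imageI finite_lessThan image_subsetI)
    then have 1: "sau_topology closure_of (leaf ` {..<k}) = leaf ` {..<k}" by (simp add: closure_of_eq)
    have leaf_fill: "leaf n \<in> fill {..<k}" if "n < k" for n
    proof -
      have "opn {leaf n}" using points.leaf leaf_neq_node[symmetric] by (auto simp: opn_def)
      then have "{leaf n} \<subseteq> fill {..<k}" by (rule fill_greatest) (use that inj_leaf in \<open>auto dest: injD\<close>)
      then show ?thesis by blast
    qed
    have "x \<notin> sau_topology closure_of (leaf ` {k..})" if "x \<in> leaf ` {..<k}" for x
    proof
      assume "x \<in> sau_topology closure_of (leaf ` {k..})"
      moreover have "x \<in> fill {..<k}" using that leaf_fill by auto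
      ultimately obtain n where "n \<ge> k" "leaf n \<in> fill {..<k}"
        using openin_fill unfolding in_closure_of by (metis atLeast_iff imageE)
      then show False using leaf_in_fillD by fastforce
    qed
    then show "sau_topology closure_of (leaf ` underS natLeq k) \<inter> sau_topology closure_of (leaf ` above natLeq k) = {}"
      unfolding u a 1 by blast
  qed
  then have "free_set sau_topology (leaf ` Field natLeq)"
    by (rule free_set_indexI) (use inj_leaf inj_on_subset in blast)
  then show ?thesis by (simp add: Field_natLeq)
qed

lemma weight_sau_topology: "weight sau_topology \<le>o |UNIV :: nat set set|"
proof -
  have "base_of sau_topology (range fill)"
    unfolding base_of_def
  proof (intro conjI ballI allI impI)
    show "openin sau_topology V" if "V \<in> range fill" for V using that openin_fill by (elim rangeE) simp
    show "\<exists>V\<in>range fill. x \<in> V \<and> V \<subseteq> U" if "openin sau_topology U \<and> x \<in> U" for U x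
    proof -
      have "\<exists>E. x \<in> fill E \<and> fill E \<subseteq> U" using that unfolding openin_sau_topology by simp
      then show ?thesis by blast
    qed
  qed
  then have "|range fill| \<in> {|\<B>| | \<B>. base_of sau_topology \<B>}" by blast
  moreover have "\<forall>r\<in>{|\<B>| | \<B>. base_of sau_topology \<B>}. Card_order r" using card_of_Card_order by blast
  ultimately have "weight sau_topology \<le>o |range fill|"
    unfolding weight_def using card_Min[of "{|\<B>| | \<B>. base_of sau_topology \<B>}"] by blast
  then show ?thesis using card_of_image ordLeq_transitive by blast
qed

lemma card_sau_topology: "|topspace sau_topology| =o |UNIV :: nat set set set|"
proof -
  have "|topspace sau_topology| \<le>o |UNIV :: nat set set set|" by (rule card_of_mono1) simp
  moreover have "|UNIV :: nat set set set| \<le>o |topspace sau_topology|"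
    using inj_basic_node basic_node_in_points by (intro card_of_ordLeqI[of basic_node]) (simp_all add: topspace_sau_topology)
  ultimately show ?thesis by (simp add: ordIso_iff_ordLeq)
qed

end

section \<open>Free sets and cardinalities\<close>

text \<open>The positions with finitely many predecessors are countably many. If the index order is
  uncountable, the least position \<open>b\<close> beyond them has infinitely many predecessors and uncountably
  many successors, so it cuts the free sequence into two infinite parts with disjoint closures.\<close>

lemma free_set_countable:
  assumes X: "strongly_anti_Urysohn X" and S: "free_set X S"
  shows "countable S"
proof (rule ccontr)
  assume unc: "uncountable S"
  obtain r :: "'a rel" and x where fs: "free_sequence X r x" and inj: "inj_on x (Field r)" and S': "x ` Field r = S"
    using S unfolding free_set_def by blast
  have r: "Well_order r" and sub: "x ` Field r \<subseteq> topspace X" using fs by (auto simp: free_sequence_def)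
  interpret r: wo_rel r using r by (simp add: wo_rel_def)
  have uncF: "uncountable (Field r)" using unc S' by blast
  define J where "J = {b \<in> Field r. finite (underS r b)}"
  have mono: "underS r a \<subset> underS r b" if "(a, b) \<in> r" "a \<noteq> b" for a b
  proof
    show "underS r a \<subseteq> underS r b"
      using that r.TRANS r.ANTISYM unfolding underS_def trans_def antisym_def by blast
    show "underS r a \<noteq> underS r b" using that unfolding underS_def by blast
  qed
  have "inj_on (\<lambda>b. card (underS r b)) J"
  proof (rule inj_onI, rule ccontr)
    fix a b assume ab: "a \<in> J" "b \<in> J" "card (underS r a) = card (underS r b)" "a \<noteq> b"
    then have "(a, b) \<in> r \<or> (b, a) \<in> r" using r.TOTALS by (auto simp: J_def)
    then have "underS r a \<subset> underS r b \<or> underS r b \<subset> underS r a" using mono ab(4) by blast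
    moreover have "finite (underS r a)" "finite (underS r b)" using ab(1,2) by (simp_all add: J_def)
    ultimately show False using ab(3) psubset_card_mono by (metis less_irrefl)
  qed
  then have cJ: "countable J" by (rule countableI)
  define I where "I = Field r - J"
  have uI: "uncountable I" using uncF cJ unfolding I_def by (simp add: uncountable_minus_countable)
  then have neI: "I \<noteq> {}" by auto
  have IF: "I \<subseteq> Field r" by (auto simp: I_def)
  define b where "b = r.minim I"
  have b: "b \<in> I" "\<And>a. a \<in> I \<Longrightarrow> (b, a) \<in> r"
    unfolding b_def using r.minim_in[OF IF neI] r.minim_least[OF IF] by blast+
  have bF: "b \<in> Field r" using b(1) IF by blast
  have inf1: "infinite (underS r b)" using b(1) by (auto simp: I_def J_def)
  have "I \<subseteq> above r b" using b(2) by (auto simp: above_def)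
  then have inf2: "infinite (above r b)" using uI countable_finite finite_subset by blast
  have big: "infinite (X closure_of (x ` Z))" if "Z \<subseteq> Field r" "infinite Z" for Z
  proof -
    have "infinite (x ` Z)" using that inj finite_image_iff inj_on_subset by metis
    moreover have "x ` Z \<subseteq> X closure_of (x ` Z)"
      using that(1) sub by (intro closure_of_subset) blast
    ultimately show ?thesis using finite_subset by blast
  qed
  have "underS r b \<subseteq> Field r" "above r b \<subseteq> Field r" by (auto simp: underS_def above_def Field_def)
  then have "X closure_of (x ` underS r b) \<inter> X closure_of (x ` above r b) \<noteq> {}"
    using X big inf1 inf2 unfolding strongly_anti_Urysohn_def by (metis closedin_closure_of)
  then show False using fs bF unfolding free_sequence_def by blast
qed

lemma free_number_SAU:
  assumes X: "strongly_anti_Urysohn X" and S: "free_set X S" "infinite S"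
  shows "free_number X =o natLeq"
proof -
  let ?K = "{|S| | S. free_set X S}"
  have card: "\<forall>r\<in>?K. Card_order r" using card_of_Card_order by blast
  have "free_number X \<le>o natLeq"
    unfolding free_number_def
  proof (rule card_Sup_least[OF card natLeq_Card_order], intro ballI)
    fix r assume "r \<in> ?K"
    then obtain T where T: "r = |T|" "countable T" using free_set_countable[OF X] by blast
    then have "|T| \<le>o |UNIV :: nat set|"
      unfolding countable_def by (meson card_of_ordLeq subset_UNIV)
    then show "r \<le>o natLeq" unfolding T(1) using card_of_nat ordLeq_ordIso_trans by blast
  qed
  moreover have "natLeq \<le>o free_number X"
  proof -
    have "natLeq \<le>o |S|" using S(2) infinite_iff_natLeq_ordLeq by blast
    moreover have "|S| \<le>o free_number X"
      unfolding free_number_def using S(1) by (intro card_Sup_upper[OF card]) blast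
    ultimately show ?thesis by (rule ordLeq_transitive)
  qed
  ultimately show ?thesis by (simp add: ordIso_iff_ordLeq)
qed

lemma continuum_ordIso: "continuum =o |UNIV :: nat set set|"
proof -
  have "continuum =o |Pow (UNIV :: nat set)|"
    unfolding continuum_def ctwo_def cexp_def Field_card_of Field_natLeq
    using card_of_Pow_Func ordIso_symmetric by blast
  then show ?thesis by simp
qed

lemma two_power_continuum_ordIso: "ctwo ^c continuum =o |UNIV :: nat set set set|"
proof -
  have "ctwo ^c continuum =o ctwo ^c |UNIV :: nat set set|"
    by (rule cexp_cong2[OF continuum_ordIso Card_order_ctwo])
      (auto simp: continuum_def Card_order_cexp card_of_Card_order)
  also have "ctwo ^c |UNIV :: nat set set| =o |Pow (UNIV :: nat set set)|"
    unfolding ctwo_def cexp_def Field_card_of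
    using card_of_Pow_Func ordIso_symmetric by blast
  finally show ?thesis by simp
qed

theorem mainTheorem2:
  shows "\<exists>X :: nat set set topology.
    Hausdorff_space X \<and>
    strongly_anti_Urysohn X \<and>
    free_number X =o natLeq \<and>
    weight X \<le>o continuum \<and>
    |topspace X| =o ctwo ^c continuum"
proof -
  obtain w :: "nat set set \<Rightarrow> nat set set"
    where w: "\<forall>z. OK_point (w z)" "\<forall>z z'. z \<noteq> z' \<longrightarrow> \<not> RK_equiv (w z) (w z')"
    using inequivalent_OK_points by (elim exE conjE)
  interpret ultrafilter_assignment w by unfold_locales (simp_all add: w)
  have "infinite (range leaf)" using inj_leaf by (rule range_inj_infinite)
  then have "free_number sau_topology =o natLeq" by (rule free_number_SAU[OF strongly_anti_Urysohn_sau_topology leaves_free])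
  moreover have "weight sau_topology \<le>o continuum"
    using weight_sau_topology continuum_ordIso ordIso_symmetric ordLeq_ordIso_trans by blast
  moreover have "|topspace sau_topology| =o ctwo ^c continuum"
    using card_sau_topology two_power_continuum_ordIso ordIso_symmetric ordIso_transitive by blast
  ultimately show ?thesis using Hausdorff_sau_topology strongly_anti_Urysohn_sau_topology by blast
qed

end
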